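(* Let $\alpha\in(1,2)$. Suppose $u_0(x)=c+m((-\infty,x])$ with $c\in\mathbb{R}$ and $m$ a finite nonnegative Borel measure on $\mathbb{R}$, and let $u$ be the solution of $u_t+\Lambda^\alpha u+uu_x=0$, $u(\cdot,0)=u_0$. Then (i) $u_x(x,t)\ge0$ for all $x\in\mathbb{R}$ and $t>0$; (ii) for every $p\in[1,\infty]$, $$\|u_x(t)\|_p\le t^{-1+1/p}\,\|m\|^{1/p}\qquad\text{for all }t>0,$$ where $\|m\|=m(\mathbb{R})$ (total variation).
   Context: $\Lambda^\alpha=(-\partial_x^2)^{\alpha/2}$ is defined by $\widehat{\Lambda^\alpha v}(\xi)=|\xi|^\alpha\widehat v(\xi)$ (for bounded smooth functions via $\Lambda^\alpha w(x)=-C(\alpha)\int_{\mathbb{R}}\frac{w(x+z)-w(x)-w_x(x)z}{|z|^{1+\alpha}}dz$). For $u_0\in L^\infty(\mathbb{R})$, "the solution" means the unique function $u$ such that for all $T>0$: $u\in C_b((0,T)\times\mathbb{R})$, $u\in C_b^\infty((a,T)\times\mathbb{R})$ for every $a\in(0,T)$, $u$ satisfies the equation on $(0,T)\times\mathbb{R}$, and $u(\cdot,t)\to u_0$ weak-$*$ in $L^\infty(\mathbb{R})$ as $t\to0$. *)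

theory Defs
  imports "HOL-Analysis.Analysis"
begin

definition pdx :: "(real \<Rightarrow> real \<Rightarrow> real) \<Rightarrow> real \<Rightarrow> real \<Rightarrow> real" where
  "pdx g = (\<lambda>x t. deriv (\<lambda>y. g y t) x)"

definition pdt :: "(real \<Rightarrow> real \<Rightarrow> real) \<Rightarrow> real \<Rightarrow> real \<Rightarrow> real" where
  "pdt g = (\<lambda>x t. deriv (\<lambda>s. g x s) t)"

fun iter_pd :: "bool list \<Rightarrow> (real \<Rightarrow> real \<Rightarrow> real) \<Rightarrow> real \<Rightarrow> real \<Rightarrow> real" where
  "iter_pd [] g = g"
| "iter_pd (b # bs) g = (if b then pdx else pdt) (iter_pd bs g)"

definition Cb_on :: "(real \<times> real) set \<Rightarrow> (real \<Rightarrow> real \<Rightarrow> real) \<Rightarrow> bool" where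
  "Cb_on S g \<longleftrightarrow> continuous_on S (\<lambda>(x,t). g x t) \<and> bounded ((\<lambda>(x,t). g x t) ` S)"

definition Cb_inf_on :: "(real \<times> real) set \<Rightarrow> (real \<Rightarrow> real \<Rightarrow> real) \<Rightarrow> bool" where
  "Cb_inf_on S g \<longleftrightarrow>
     (\<forall>ds. Cb_on S (iter_pd ds g) \<and>
        (\<forall>(x,t)\<in>S. (\<lambda>y. iter_pd ds g y t) differentiable (at x) \<and>
                    (\<lambda>s. iter_pd ds g x s) differentiable (at t)))"

text \<open>Normalising constant C(alpha) in dimension one, chosen so that the symbol of
  the operator is |xi|^alpha.\<close>
definition frac_const :: "real \<Rightarrow> real" where
  "frac_const \<alpha> = 2 powr \<alpha> * Gamma ((1 + \<alpha>) / 2) / (sqrt pi * \<bar>Gamma (- \<alpha> / 2)\<bar>)"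

definition frac_lap :: "real \<Rightarrow> (real \<Rightarrow> real) \<Rightarrow> real \<Rightarrow> real" where
  "frac_lap \<alpha> w x = - frac_const \<alpha> *
     (LINT z|lborel. (w (x + z) - w x - deriv w x * z) / \<bar>z\<bar> powr (1 + \<alpha>))"

definition is_solution :: "real \<Rightarrow> (real \<Rightarrow> real) \<Rightarrow> (real \<Rightarrow> real \<Rightarrow> real) \<Rightarrow> bool" where
  "is_solution \<alpha> u0 u \<longleftrightarrow>
     (\<forall>T>0.
        Cb_on (UNIV \<times> {0<..<T}) u \<and>
        (\<forall>a\<in>{0<..<T}. Cb_inf_on (UNIV \<times> {a<..<T}) u) \<and>
        (\<forall>x. \<forall>t\<in>{0<..<T}.
           pdt u x t + frac_lap \<alpha> (\<lambda>y. u y t) x + u x t * pdx u x t = 0)) \<and>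
     (\<forall>\<phi>. integrable lborel \<phi> \<longrightarrow>
        ((\<lambda>t. LINT x|lborel. u x t * \<phi> x) \<longlongrightarrow> (LINT x|lborel. u0 x * \<phi> x)) (at_right 0))"

end

theory Submission
  imports Defs
begin

text \<open>If \<open>f\<^sub>t + \<Lambda>f + b f\<^sub>x = 0\<close> with bounded \<open>b\<close>, then at a maximum of \<open>f (x + a) t - f x t\<close> minus a linear
  function of \<open>a\<close> the two space derivatives agree and the nonlocal term has a sign, so increments
  obey a maximum principle; a penalty of linear growth in \<open>x\<close> and \<open>a\<close> makes the maximum exist.
  The initial value is only attained weak-*, so the principle is applied to the window integrals
  \<open>\<integral> u (x + s) t ds\<close> over \<open>0 \<le> s \<le> h\<close>. These do converge locally uniformly, and they solve such an
  equation with \<open>b = (u (x + h) t + u x t) / 2\<close>. Dividing by \<open>h\<close> shows that \<open>u\<close> is nondecreasing with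
  oscillation at most the mass of \<open>m\<close>. Applied to \<open>u\<close> itself from a positive time on, the
  principle gives \<open>u\<^sub>x \<le> 1 / t\<close>, and the bounds for finite \<open>p\<close> follow by interpolation.\<close>

section \<open>The singular integrand and its integrable majorant\<close>

definition levy_quot :: "real \<Rightarrow> (real \<Rightarrow> real) \<Rightarrow> real \<Rightarrow> real \<Rightarrow> real" where
  "levy_quot \<alpha> w x z = (w (x + z) - w x - deriv w x * z) / \<bar>z\<bar> powr (1 + \<alpha>)"

text \<open>Up to a constant, \<open>min (z\<^sup>2) \<bar>z\<bar>\<close> is the size of the
  first-order Taylor remainder of a function with bounded first and second derivatives: quadratic
  for small \<open>z\<close>, linear for large \<open>z\<close>.\<close>

definition levy_bound :: "real \<Rightarrow> real \<Rightarrow> real" where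
  "levy_bound \<alpha> z = min (z\<^sup>2) \<bar>z\<bar> / \<bar>z\<bar> powr (1 + \<alpha>)"

lemma frac_lap_levy_quot:
  "frac_lap \<alpha> w x = - frac_const \<alpha> * (LINT z|lborel. levy_quot \<alpha> w x z)"
  by (simp add: frac_lap_def levy_quot_def)

lemma frac_const_nonneg:
  assumes "0 < \<alpha>" shows "0 \<le> frac_const \<alpha>"
proof -
  have "Gamma ((1 + \<alpha>) / 2) > 0" using assms by (intro Gamma_real_pos) auto
  then show ?thesis by (simp add: frac_const_def)
qed

lemma levy_bound_nonneg: "0 \<le> levy_bound \<alpha> z"
  by (simp add: levy_bound_def)

lemma levy_bound_measurable [measurable]: "levy_bound \<alpha> \<in> borel_measurable borel"
  unfolding levy_bound_def by measurable

text \<open>Near 0 the function is \<open>\<bar>z\<bar> powr (1 - \<alpha>)\<close>, integrable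
  because \<open>\<alpha> < 2\<close>; at infinity it is
  \<open>\<bar>z\<bar> powr (- \<alpha>)\<close>, integrable because \<open>1 < \<alpha>\<close>. In
  the proof \<open>k\<close> covers the positive half-line and its reflection the negative
  one.\<close>

lemma integrable_levy_bound:
  assumes "1 < \<alpha>" "\<alpha> < 2"
  shows "integrable lborel (levy_bound \<alpha>)"
proof -
  have "(\<lambda>z. z powr (1 - \<alpha>)) absolutely_integrable_on {0..1}"
    using assms by (intro nonnegative_absolutely_integrable_1 integrable_on_powr_from_0) auto
  then have 1: "integrable lborel (\<lambda>z. indicator {0..1} z * z powr (1 - \<alpha>))"
    by (simp add: set_integrable_def integrable_completion)
  have "(\<lambda>z. z powr (- \<alpha>)) absolutely_integrable_on {1..}"
    using assms by (intro nonnegative_absolutely_integrable_1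
        has_integral_integrable[OF has_integral_powr_to_inf]) auto
  then have 2: "integrable lborel (\<lambda>z. indicator {1..} z * z powr (- \<alpha>))"
    by (simp add: set_integrable_def integrable_completion)
  define k where "k = (\<lambda>z::real. indicator {0..1} z * z powr (1 - \<alpha>) + indicator {1..} z * z powr (- \<alpha>))"
  have 3: "integrable lborel k"
    unfolding k_def using 1 2 by (rule Bochner_Integration.integrable_add)
  have "integrable lborel (\<lambda>z. k (0 + (-1) * z))"
    using lborel_integrable_real_affine[OF 3, of "-1" 0] by simp
  then have 4: "integrable lborel (\<lambda>z. k z + k (- z))"
    using 3 by simp
  have pos: "levy_bound \<alpha> z \<le> k z" if "z > 0" for z
  proof (cases "z \<le> 1")
    case True
    have "levy_bound \<alpha> z \<le> z\<^sup>2 / z powr (1 + \<alpha>)"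
      using that by (simp add: levy_bound_def divide_right_mono)
    also have "\<dots> = z powr (2 - (1 + \<alpha>))"
      using that by (subst powr_diff) simp
    also have "\<dots> \<le> k z" using that True by (simp add: k_def)
    finally show ?thesis .
  next
    case False
    have "levy_bound \<alpha> z \<le> z / z powr (1 + \<alpha>)"
      using that by (simp add: levy_bound_def divide_right_mono)
    also have "\<dots> = z powr (1 - (1 + \<alpha>))"
      using that by (subst powr_diff) simp
    also have "\<dots> \<le> k z" using that False by (simp add: k_def)
    finally show ?thesis .
  qed
  have k0: "k z \<ge> 0" for z by (simp add: k_def)
  have "levy_bound \<alpha> z \<le> k z + k (- z)" for z
  proof -
    have "levy_bound \<alpha> z = levy_bound \<alpha> \<bar>z\<bar>" by (simp add: levy_bound_def)
    moreover have "k \<bar>z\<bar> \<le> k z + k (- z)" using k0[of z] k0[of "-z"] by (simp add: abs_if)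
    moreover have "levy_bound \<alpha> 0 = 0" by (simp add: levy_bound_def)
    ultimately show ?thesis using pos[of "\<bar>z\<bar>"] k0[of z] k0[of "-z"] by (cases "z = 0") auto
  qed
  then show ?thesis
    by (intro Bochner_Integration.integrable_bound[OF 4])
      (auto simp: levy_bound_nonneg intro!: order_trans[OF _ abs_ge_self])
qed

section \<open>A maximum principle for space increments\<close>

text \<open>Controls the contribution of the penalty \<open>sqrt (1 + x\<^sup>2)\<close> to the
  nonlocal term. With \<open>A\<close> and \<open>B\<close> for the two roots, the quadratic bound
  follows from \<open>B\<^sup>2 - A\<^sup>2 = (2 * x + z) * z\<close> and the nonnegativity of
  \<open>(B - A)\<^sup>2\<close>, the linear one from the root being 1-Lipschitz.\<close>

lemma bracket_diff_le:
  fixes x z :: real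
  shows "sqrt (1 + (x + z)\<^sup>2) - sqrt (1 + x\<^sup>2) - x / sqrt (1 + x\<^sup>2) * z \<le> 2 * min (z\<^sup>2) \<bar>z\<bar>"
proof -
  define A where "A = sqrt (1 + x\<^sup>2)"
  define B where "B = sqrt (1 + (x + z)\<^sup>2)"
  have A: "A \<ge> 1" "A\<^sup>2 = 1 + x\<^sup>2" "\<bar>x\<bar> \<le> A"
    unfolding A_def by (auto simp: intro: real_le_rsqrt)
  have B: "B \<ge> 1" "B\<^sup>2 = 1 + (x + z)\<^sup>2" "\<bar>x + z\<bar> \<le> B"
    unfolding B_def by (auto simp: intro: real_le_rsqrt)
  have eq: "(B - A) * (B + A) = (2 * x + z) * z"
    using A(2) B(2) by (simp add: algebra_simps power2_eq_square)
  have "2 * A * (B - A) \<le> 2 * x * z + z\<^sup>2"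
    using eq zero_le_power2[of "B - A"] by (simp add: algebra_simps power2_eq_square)
  then have "(2 * A * (B - A) - 2 * x * z) / (2 * A) \<le> z\<^sup>2 / (2 * A)"
    using A(1) by (intro divide_right_mono) auto
  moreover have "(2 * A * (B - A) - 2 * x * z) / (2 * A) = B - A - x / A * z"
    using A(1) by (simp add: diff_divide_distrib)
  ultimately have "B - A - x / A * z \<le> z\<^sup>2 / (2 * A)" by simp
  also have "\<dots> \<le> z\<^sup>2 / 1" using A(1) by (intro divide_left_mono) auto
  finally have 1: "B - A - x / A * z \<le> z\<^sup>2" by simp
  have "\<bar>B - A\<bar> * (B + A) = \<bar>2 * x + z\<bar> * \<bar>z\<bar>"
    using eq A(1) B(1) by (metis abs_mult abs_of_nonneg add_nonneg_nonneg order_trans zero_le_one)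
  also have "\<dots> \<le> (B + A) * \<bar>z\<bar>"
    using A(3) B(3) by (intro mult_right_mono) auto
  finally have 2: "\<bar>B - A\<bar> \<le> \<bar>z\<bar>" using A(1) B(1) by (simp add: mult.commute)
  have "\<bar>x / A * z\<bar> \<le> 1 * \<bar>z\<bar>"
    unfolding abs_mult using A by (intro mult_right_mono) (auto simp: field_simps)
  then have "B - A - x / A * z \<le> 2 * \<bar>z\<bar>" using 2 by linarith
  then have "B - A - x / A * z \<le> 2 * min (z\<^sup>2) \<bar>z\<bar>"
    using 1 zero_le_power2[of z] by linarith
  then show ?thesis unfolding A_def B_def .
qed

text \<open>At a maximum of the penalised excess over \<open>k + a * g t\<close>, the first-order
  conditions in \<open>a\<close> and \<open>x\<close> give both space derivatives, the nonlocal
  terms are ordered up to the penalty, and the equation then contradicts the sign of the time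
  derivative. \<open>super\<close> is asked for only where the bound fails, so that the failure
  itself can help to verify it. \<open>init\<close> is local in \<open>x\<close> and
  \<open>a\<close>, because the penalty confines the maximum, and concerns times after
  \<open>t0\<close> only, so no value at \<open>t0\<close> enters. \<open>int\<close> is there
  because the integral of a nonintegrable function is the default 0, which allows no
  comparison.\<close>

lemma two_point_maximum_principle:
  fixes f b :: "real \<Rightarrow> real \<Rightarrow> real" and g g' :: "real \<Rightarrow> real"
  assumes \<alpha>: "1 < \<alpha>" "\<alpha> < 2"
    and cont: "continuous_on (UNIV \<times> {t0<..<T}) (\<lambda>(x,t). f x t)"
    and f_le: "\<And>x t. t \<in> {t0<..<T} \<Longrightarrow> \<bar>f x t\<bar> \<le> M"
    and b_le: "\<And>x t. t \<in> {t0<..<T} \<Longrightarrow> \<bar>b x t\<bar> \<le> N"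
    and dx: "\<And>x t. t \<in> {t0<..<T} \<Longrightarrow> (\<lambda>y. f y t) differentiable (at x)"
    and dt: "\<And>x t. t \<in> {t0<..<T} \<Longrightarrow> (\<lambda>s. f x s) differentiable (at t)"
    and int: "\<And>x t. t \<in> {t0<..<T} \<Longrightarrow> integrable lborel (levy_quot \<alpha> (\<lambda>y. f y t) x)"
    and eq: "\<And>x t. t \<in> {t0<..<T} \<Longrightarrow>
               pdt f x t + frac_lap \<alpha> (\<lambda>y. f y t) x + b x t * pdx f x t = 0"
    and k: "0 \<le> k"
    and g: "\<And>t. t \<in> {t0<..<T} \<Longrightarrow> 0 \<le> g t"
    and g': "\<And>t. t \<in> {t0<..<T} \<Longrightarrow> (g has_real_derivative g' t) (at t)"
    and super: "\<And>x a t. t \<in> {t0<..<T} \<Longrightarrow> 0 < a \<Longrightarrow> f (x + a) t - f x t > k + a * g t \<Longrightarrow>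
               0 \<le> a * g' t + (b (x + a) t - b x t) * g t"
    and init: "\<And>R \<eta>. 0 < R \<Longrightarrow> 0 < \<eta> \<Longrightarrow> \<exists>\<tau>>t0. \<forall>t\<in>{t0<..<\<tau>}. \<forall>x a.
               \<bar>x\<bar> \<le> R \<longrightarrow> 0 \<le> a \<longrightarrow> a \<le> R \<longrightarrow> f (x + a) t - f x t \<le> k + a * g t + \<eta>"
    and t1: "t1 \<in> {t0<..<T}" and a1: "0 \<le> a1"
  shows "f (x1 + a1) t1 - f x1 t1 \<le> k + a1 * g t1"
proof (rule ccontr)
  assume neg: "\<not> ?thesis"
  define P where "P = (\<lambda>x a t. f (x + a) t - f x t - k - a * g t)"
  define \<Theta> where "\<Theta> = (\<lambda>x::real. sqrt (1 + x\<^sup>2))"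
  define I0 where "I0 = (LINT z|lborel. 2 * levy_bound \<alpha> z)"
  \<comment> \<open>The slope \<open>\<epsilon> * L\<close> in time has to beat what the penalty
    adds to the equation at the maximum: \<open>\<epsilon> * I0\<close> times
    \<open>frac_const \<alpha>\<close> from the nonlocal term and three drift terms of size at most
    \<open>\<epsilon> * N\<close>. The summand 1 makes this strict.\<close>
  define L where "L = 1 + 3 * \<bar>N\<bar> + frac_const \<alpha> * I0"
  have fc: "0 \<le> frac_const \<alpha>" using \<alpha> by (intro frac_const_nonneg) auto
  have I0: "0 \<le> I0" unfolding I0_def by (intro integral_nonneg_AE) (auto simp: levy_bound_nonneg)
  have L: "1 \<le> L" unfolding L_def using fc I0 by simp
  have \<Theta>: "\<bar>x\<bar> \<le> \<Theta> x" for x unfolding \<Theta>_def by (auto intro: real_le_rsqrt)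
  \<comment> \<open>\<open>\<epsilon> * S\<close> exceeds the penalty at
    \<open>(x1, a1, t1)\<close>, so taking \<open>\<epsilon>\<close> as the violation there divided
    by \<open>2 * S\<close> loses at most half of it.\<close>
  define S where "S = \<Theta> x1 + a1 + L * (t1 - t0) + 1"
  have S: "S > 0" using \<Theta>[of x1] a1 t1 L unfolding S_def by (auto intro!: add_nonneg_pos add_nonneg_nonneg)
  have P1: "P x1 a1 t1 > 0" using neg by (simp add: P_def)
  define \<epsilon> where "\<epsilon> = P x1 a1 t1 / (2 * S)"
  have \<epsilon>: "\<epsilon> > 0" using P1 S by (simp add: \<epsilon>_def)
  define \<Psi> where "\<Psi> = (\<lambda>x a t. P x a t - \<epsilon> * (\<Theta> x + a + L * (t - t0)))"
  have "\<epsilon> * (\<Theta> x1 + a1 + L * (t1 - t0)) \<le> \<epsilon> * S"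
    using \<epsilon> by (intro mult_left_mono) (auto simp: S_def)
  also have "\<epsilon> * S = P x1 a1 t1 / 2" using S by (simp add: \<epsilon>_def)
  finally have \<Psi>1: "\<Psi> x1 a1 t1 > 0" using P1 by (simp add: \<Psi>_def)
  \<comment> \<open>Where \<open>\<Psi>\<close> is positive,
    \<open>\<epsilon> * (\<bar>x\<bar> + a)\<close> is at most \<open>2 * \<bar>M\<bar>\<close>, so
    \<open>R\<close> confines both variables; adding 1 makes it positive, as \<open>init\<close>
    demands.\<close>
  define R where "R = 2 * \<bar>M\<bar> / \<epsilon> + 1"
  have R: "R > 0" unfolding R_def using \<epsilon> by (auto intro!: add_nonneg_pos)
  have \<Psi>_le: "\<Psi> x a t \<le> 2 * \<bar>M\<bar> - \<epsilon> * (\<bar>x\<bar> + a)" if "t \<in> {t0<..<T}" "0 \<le> a" for x a t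
  proof -
    have "f (x + a) t - f x t \<le> 2 * \<bar>M\<bar>" using f_le[OF that(1), of x] f_le[OF that(1), of "x + a"] by linarith
    moreover have "0 \<le> a * g t" using that g by auto
    moreover have "\<epsilon> * (\<bar>x\<bar> + a) \<le> \<epsilon> * (\<Theta> x + a + L * (t - t0))"
      using \<epsilon> \<Theta>[of x] L that by (intro mult_left_mono) (auto intro!: add_increasing2)
    ultimately show ?thesis using k unfolding \<Psi>_def P_def by linarith
  qed
  have bounded: "\<bar>x\<bar> \<le> R \<and> a \<le> R" if "t \<in> {t0<..<T}" "0 \<le> a" "0 < \<Psi> x a t" for x a t
  proof -
    have "\<epsilon> * (\<bar>x\<bar> + a) \<le> 2 * \<bar>M\<bar>" using \<Psi>_le[OF that(1,2), of x] that(3) by linarith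
    then have "\<bar>x\<bar> + a \<le> 2 * \<bar>M\<bar> / \<epsilon>" using \<epsilon> by (simp add: field_simps)
    then show ?thesis using that(2) unfolding R_def by linarith
  qed
  obtain \<tau>0 where \<tau>0: "\<tau>0 > t0" and \<tau>0_le: "\<And>t x a. t \<in> {t0<..<\<tau>0} \<Longrightarrow> \<bar>x\<bar> \<le> R \<Longrightarrow> 0 \<le> a \<Longrightarrow> a \<le> R \<Longrightarrow>
      f (x + a) t - f x t \<le> k + a * g t + \<Psi> x1 a1 t1 / 2"
    using init[OF R, of "\<Psi> x1 a1 t1 / 2"] \<Psi>1 by auto
  \<comment> \<open>Continuity is known only after \<open>t0\<close>, so the compact set starts at a
    later time; keeping it below \<open>\<tau>0\<close> lets \<open>init\<close> exclude a maximum
    at the initial face.\<close>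
  define \<tau> where "\<tau> = (t0 + min \<tau>0 t1) / 2"
  have \<tau>: "t0 < \<tau>" "\<tau> < \<tau>0" "\<tau> < t1" using \<tau>0 t1 by (auto simp: \<tau>_def min_def)
  define K where "K = {-R..R} \<times> {0..R} \<times> {\<tau>..t1}"
  have sub: "{\<tau>..t1} \<subseteq> {t0<..<T}" using \<tau> t1 by auto
  have g_cont: "continuous_on {\<tau>..t1} g"
    using g' sub by (intro continuous_at_imp_continuous_on) (blast intro: DERIV_isCont)
  have cf: "continuous_on K (\<lambda>q. (\<lambda>(x,t). f x t) (fst q, snd (snd q)))"
    by (rule continuous_on_compose2[OF cont])
      (use sub in \<open>auto simp: K_def intro!: continuous_intros\<close>)
  have cf': "continuous_on K (\<lambda>q. (\<lambda>(x,t). f x t) (fst q + fst (snd q), snd (snd q)))"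
    by (rule continuous_on_compose2[OF cont])
      (use sub in \<open>auto simp: K_def intro!: continuous_intros\<close>)
  have cg: "continuous_on K (\<lambda>q. g (snd (snd q)))"
    by (rule continuous_on_compose2[OF g_cont]) (auto simp: K_def intro!: continuous_intros)
  have "continuous_on K (\<lambda>(x,a,t). \<Psi> x a t)"
    using cf cf' cg unfolding \<Psi>_def P_def \<Theta>_def case_prod_unfold fst_conv snd_conv
    by (intro continuous_intros)
  moreover have "compact K" unfolding K_def by (intro compact_Times) auto
  moreover have K1: "(x1, a1, t1) \<in> K"
    using bounded[OF t1 a1 \<Psi>1] a1 \<tau> unfolding K_def by auto
  ultimately obtain p where "p \<in> K" and p: "\<And>q. q \<in> K \<Longrightarrow> (case q of (x,a,t) \<Rightarrow> \<Psi> x a t) \<le> (case p of (x,a,t) \<Rightarrow> \<Psi> x a t)"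
    using continuous_attains_sup[of K "\<lambda>(x,a,t). \<Psi> x a t"] by blast
  obtain x a t where xat: "p = (x, a, t)" by (cases p)
  have max_K: "\<And>x' a' t'. (x', a', t') \<in> K \<Longrightarrow> \<Psi> x' a' t' \<le> \<Psi> x a t"
    using p xat by auto
  have pos: "\<Psi> x a t \<ge> \<Psi> x1 a1 t1" using max_K[OF K1] .
  have t: "\<tau> \<le> t" "t \<le> t1" "t \<in> {t0<..<T}" and a0: "0 \<le> a" "a \<le> R" and xR: "\<bar>x\<bar> \<le> R"
    using \<open>p \<in> K\<close> xat sub unfolding K_def by auto
  \<comment> \<open>Outside \<open>K\<close> the function is not positive, so the maximum is global
    in \<open>x'\<close> and in nonnegative \<open>a'\<close>. The nonlocal term needs this, as it
    looks at all shifts \<open>x + z\<close>.\<close>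
  have max: "\<Psi> x' a' t' \<le> \<Psi> x a t" if "0 \<le> a'" "t' \<in> {\<tau>..t1}" for x' a' t'
  proof (rule ccontr)
    assume *: "\<not> \<Psi> x' a' t' \<le> \<Psi> x a t"
    have "t' \<in> {t0<..<T}" using that sub by auto
    from bounded[OF this that(1), of x'] * pos \<Psi>1 have "(x', a', t') \<in> K"
      using that unfolding K_def by auto
    from max_K[OF this] * show False by simp
  qed
  have pen: "0 \<le> \<epsilon> * (\<Theta> x + a + L * (t - t0))"
    using \<epsilon> a0 \<Theta>[of x] L t(3) by (intro mult_nonneg_nonneg add_nonneg_nonneg) auto
  have \<Psi>_eq: "\<Psi> x a t = f (x + a) t - f x t - k - a * g t - \<epsilon> * (\<Theta> x + a + L * (t - t0))"
    by (simp add: \<Psi>_def P_def)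
  have "t \<noteq> \<tau>"
  proof
    assume "t = \<tau>"
    then have "f (x + a) t - f x t \<le> k + a * g t + \<Psi> x1 a1 t1 / 2"
      using \<tau>0_le[of \<tau> x a] \<tau> xR a0 by auto
    with \<Psi>_eq pen pos \<Psi>1 show False by linarith
  qed
  then have t\<tau>: "\<tau> < t" using t(1) by auto
  have Ppos: "f (x + a) t - f x t > k + a * g t"
    using pos \<Psi>1 pen \<Psi>_eq by linarith
  \<comment> \<open>At \<open>a = 0\<close> the increment vanishes and cannot exceed
    \<open>k\<close>; hence the maximum is interior in \<open>a\<close> and the derivative in
    \<open>a\<close> vanishes there.\<close>
  then have a: "a > 0" using k a0 by (cases "a = 0") auto
  have fx: "((\<lambda>y. f y t) has_real_derivative pdx f y t) (at y)" for y
    using dx[OF t(3)] unfolding pdx_def by (simp add: DERIV_deriv_iff_real_differentiable)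
  have ft: "((\<lambda>s. f y s) has_real_derivative pdt f y t) (at t)" for y
    using dt[OF t(3)] unfolding pdt_def by (simp add: DERIV_deriv_iff_real_differentiable)
  \<comment> \<open>The condition in \<open>a\<close> gives the value of the derivative at
    \<open>x + a\<close>, and the condition in \<open>x\<close> then gives the one at
    \<open>x\<close>; the drift terms need these values and not just their difference.\<close>
  have da: "pdx f (x + a) t = g t + \<epsilon>"
  proof -
    have "((\<lambda>a. \<Psi> x a t) has_real_derivative pdx f (x + a) t - g t - \<epsilon>) (at a)"
      unfolding \<Psi>_def P_def
      by (auto intro!: derivative_eq_intros DERIV_chain2[OF fx])
    moreover have "\<forall>a'. \<bar>a - a'\<bar> < a \<longrightarrow> \<Psi> x a' t \<le> \<Psi> x a t"
      using max t by auto
    ultimately have "pdx f (x + a) t - g t - \<epsilon> = 0"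
      using a DERIV_local_max by blast
    then show ?thesis by simp
  qed
  define \<Theta>' where "\<Theta>' = x / sqrt (1 + x\<^sup>2)"
  have \<Theta>': "\<bar>\<Theta>'\<bar> \<le> 1"
  proof -
    have "0 < sqrt (1 + x\<^sup>2)" by (simp add: add_pos_nonneg)
    then show ?thesis using \<Theta>[of x] unfolding \<Theta>'_def \<Theta>_def by simp
  qed
  have d\<Theta>: "(\<Theta> has_real_derivative \<Theta>') (at x)"
  proof -
    have "0 < 1 + x\<^sup>2" by (simp add: add_pos_nonneg)
    then show ?thesis unfolding \<Theta>_def \<Theta>'_def
      by (auto intro!: derivative_eq_intros simp: divide_simps)
  qed
  have dx': "pdx f (x + a) t - pdx f x t = \<epsilon> * \<Theta>'"
  proof -
    have "((\<lambda>x. \<Psi> x a t) has_real_derivative pdx f (x + a) t - pdx f x t - \<epsilon> * \<Theta>') (at x)"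
      unfolding \<Psi>_def P_def
      by (auto intro!: derivative_eq_intros DERIV_chain2[OF fx] d\<Theta> fx)
    moreover have "\<forall>x'. \<bar>x - x'\<bar> < 1 \<longrightarrow> \<Psi> x' a t \<le> \<Psi> x a t"
      using max t a by auto
    ultimately have "pdx f (x + a) t - pdx f x t - \<epsilon> * \<Theta>' = 0"
      using DERIV_local_max zero_less_one by blast
    then show ?thesis by simp
  qed
  \<comment> \<open>The maximum may sit at the final time \<open>t1\<close>, so only earlier times
    are compared and only an inequality results.\<close>
  have dt': "0 \<le> pdt f (x + a) t - pdt f x t - a * g' t - \<epsilon> * L"
  proof (rule ccontr)
    assume *: "\<not> ?thesis"
    have "((\<lambda>t. \<Psi> x a t) has_real_derivative pdt f (x + a) t - pdt f x t - a * g' t - \<epsilon> * L) (at t)"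
      unfolding \<Psi>_def P_def
      by (auto intro!: derivative_eq_intros ft g' t)
    from DERIV_neg_dec_left[OF this] * obtain d where d: "d > 0" "\<And>h. 0 < h \<Longrightarrow> h < d \<Longrightarrow> \<Psi> x a t < \<Psi> x a (t - h)"
      by force
    define h where "h = min (d/2) (t - \<tau>)"
    have "0 < h" "h < d" "h \<le> t - \<tau>" using d(1) t\<tau> by (auto simp: h_def)
    with d(2)[of h] max[of a "t - h" x] a t show False by auto
  qed
  \<comment> \<open>Shifting \<open>x\<close> by \<open>z\<close> with \<open>a\<close> fixed moves
    both points together, which compares the two integrands for each \<open>z\<close>; the error is
    the Taylor remainder of the penalty.\<close>
  have quot: "levy_quot \<alpha> (\<lambda>y. f y t) (x + a) z - levy_quot \<alpha> (\<lambda>y. f y t) x z \<le> \<epsilon> * (2 * levy_bound \<alpha> z)" for z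
  proof -
    have "\<Psi> (x + z) a t \<le> \<Psi> x a t" using max a t by auto
    then have "f (x + z + a) t - f (x + z) t - (f (x + a) t - f x t) \<le> \<epsilon> * (\<Theta> (x + z) - \<Theta> x)"
      unfolding \<Psi>_def P_def by (simp add: algebra_simps)
    then have "(f (x + a + z) t - f (x + a) t - pdx f (x + a) t * z) - (f (x + z) t - f x t - pdx f x t * z)
       \<le> \<epsilon> * (\<Theta> (x + z) - \<Theta> x) - (pdx f (x + a) t - pdx f x t) * z"
      by (simp add: algebra_simps)
    also have "\<dots> = \<epsilon> * (\<Theta> (x + z) - \<Theta> x - \<Theta>' * z)"
      unfolding dx' by (simp add: algebra_simps)
    also have "\<dots> \<le> \<epsilon> * (2 * min (z\<^sup>2) \<bar>z\<bar>)"
      using bracket_diff_le[of x z] \<epsilon> unfolding \<Theta>_def \<Theta>'_def by (intro mult_left_mono) auto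
    finally show ?thesis
      unfolding levy_quot_def levy_bound_def pdx_def diff_divide_distrib[symmetric] times_divide_eq_right
      by (intro divide_right_mono) auto
  qed
  have "(LINT z|lborel. levy_quot \<alpha> (\<lambda>y. f y t) (x + a) z) - (LINT z|lborel. levy_quot \<alpha> (\<lambda>y. f y t) x z)
     = (LINT z|lborel. levy_quot \<alpha> (\<lambda>y. f y t) (x + a) z - levy_quot \<alpha> (\<lambda>y. f y t) x z)"
    using int[OF t(3)] by (intro Bochner_Integration.integral_diff[symmetric]) auto
  also have "\<dots> \<le> (LINT z|lborel. \<epsilon> * (2 * levy_bound \<alpha> z))"
    using int[OF t(3)] integrable_levy_bound[OF \<alpha>] quot
    by (intro integral_mono Bochner_Integration.integrable_diff integrable_mult_right) auto
  also have "\<dots> = \<epsilon> * I0" unfolding I0_def by simp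
  finally have "frac_const \<alpha> * ((LINT z|lborel. levy_quot \<alpha> (\<lambda>y. f y t) (x + a) z) - (LINT z|lborel. levy_quot \<alpha> (\<lambda>y. f y t) x z))
     \<le> frac_const \<alpha> * (\<epsilon> * I0)" using fc by (intro mult_left_mono)
  then have "pdt f (x + a) t - pdt f x t \<le> \<epsilon> * (frac_const \<alpha> * I0)
      - b (x + a) t * pdx f (x + a) t + b x t * pdx f x t"
    using eq[OF t(3), of x] eq[OF t(3), of "x + a"] unfolding frac_lap_levy_quot by (simp add: algebra_simps)
  also have "pdx f x t = g t + \<epsilon> - \<epsilon> * \<Theta>'" using da dx' by simp
  finally have "pdt f (x + a) t - pdt f x t \<le> \<epsilon> * (frac_const \<alpha> * I0 - b (x + a) t + b x t - b x t * \<Theta>')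
      - (b (x + a) t - b x t) * g t"
    unfolding da by (simp add: algebra_simps)
  moreover have "\<epsilon> * (frac_const \<alpha> * I0 - b (x + a) t + b x t - b x t * \<Theta>') < \<epsilon> * L"
  proof -
    have "\<bar>b x t * \<Theta>'\<bar> \<le> N * 1" unfolding abs_mult using b_le[OF t(3), of x] \<Theta>' by (intro mult_mono) auto
    then show ?thesis using \<epsilon> b_le[OF t(3), of x] b_le[OF t(3), of "x + a"] unfolding L_def
      by (intro mult_strict_left_mono) auto
  qed
  ultimately show False using dt' super[OF t(3) a Ppos] by linarith
qed

section \<open>The nonlocal operator on smooth functions and on window integrals\<close>

text \<open>The linear bound is the mean value inequality for \<open>w\<close>. The quadratic one is
  the same inequality for \<open>w y - w' x * y\<close>, whose derivative is at most
  \<open>B * \<bar>z\<bar>\<close> between \<open>x\<close> and \<open>x + z\<close>.\<close>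

lemma levy_quot_le:
  assumes w: "\<And>y. (w has_real_derivative w' y) (at y)"
    and w': "\<And>y. (w' has_real_derivative w'' y) (at y)"
    and B: "\<And>y. \<bar>w' y\<bar> \<le> B" "\<And>y. \<bar>w'' y\<bar> \<le> B"
  shows "\<bar>levy_quot \<alpha> w x z\<bar> \<le> 2 * B * levy_bound \<alpha> z"
proof -
  let ?S = "closed_segment x (x + z)"
  have B0: "0 \<le> B" using B(1)[of 0] by linarith
  have lip: "\<bar>w' y - w' x\<bar> \<le> B * \<bar>y - x\<bar>" for y
    using field_differentiable_bound[of UNIV w' w'' B y x] w' B(2) by simp
  have "\<bar>w (x + z) - w x\<bar> \<le> B * \<bar>z\<bar>"
    using field_differentiable_bound[of UNIV w w' B "x + z" x] w B(1) by simp
  moreover have "\<bar>w' x * z\<bar> \<le> B * \<bar>z\<bar>"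
    unfolding abs_mult using B(1) by (intro mult_right_mono) auto
  ultimately have 1: "\<bar>w (x + z) - w x - w' x * z\<bar> \<le> 2 * B * \<bar>z\<bar>" by linarith
  have "norm ((w (x + z) - w' x * (x + z)) - (w x - w' x * x)) \<le> (B * \<bar>z\<bar>) * norm ((x + z) - x)"
  proof (rule field_differentiable_bound[of ?S _ "\<lambda>y. w' y - w' x"])
    show "((\<lambda>y. w y - w' x * y) has_field_derivative w' y - w' x) (at y within ?S)" for y
      using DERIV_subset[OF w] by (auto intro!: derivative_eq_intros)
    show "norm (w' y - w' x) \<le> B * \<bar>z\<bar>" if "y \<in> ?S" for y
    proof -
      have "\<bar>y - x\<bar> \<le> \<bar>z\<bar>"
        using that by (auto simp: closed_segment_eq_real_ivl split: if_splits)
      then show ?thesis using lip[of y] mult_left_mono[OF _ B0] order_trans by (fastforce simp: abs_minus_commute)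
    qed
  qed auto
  then have "\<bar>w (x + z) - w x - w' x * z\<bar> \<le> B * z\<^sup>2"
    by (simp add: algebra_simps power2_eq_square abs_mult_self)
  also have "\<dots> \<le> 2 * B * z\<^sup>2" using B0 by (intro mult_right_mono) auto
  finally have "\<bar>w (x + z) - w x - w' x * z\<bar> \<le> 2 * B * min (z\<^sup>2) \<bar>z\<bar>"
    using 1 by (simp add: min_def)
  moreover have "deriv w x = w' x" using w by (rule DERIV_imp_deriv)
  ultimately show ?thesis
    by (simp add: levy_quot_def levy_bound_def abs_divide divide_right_mono)
qed

lemma integrable_levy_quot:
  assumes \<alpha>: "1 < \<alpha>" "\<alpha> < 2"
    and w: "\<And>y. (w has_real_derivative w' y) (at y)"
    and w': "\<And>y. (w' has_real_derivative w'' y) (at y)"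
    and B: "\<And>y. \<bar>w' y\<bar> \<le> B" "\<And>y. \<bar>w'' y\<bar> \<le> B"
  shows "integrable lborel (levy_quot \<alpha> w x)"
proof (rule Bochner_Integration.integrable_bound)
  show "integrable lborel (\<lambda>z. 2 * B * levy_bound \<alpha> z)"
    using integrable_levy_bound[OF \<alpha>] by (rule integrable_mult_right)
  have [measurable]: "w \<in> borel_measurable borel"
    using w by (intro borel_measurable_continuous_onI continuous_at_imp_continuous_on)
      (blast intro: DERIV_isCont)
  show "levy_quot \<alpha> w x \<in> borel_measurable lborel"
    unfolding levy_quot_def by measurable
  show "AE z in lborel. norm (levy_quot \<alpha> w x z) \<le> norm (2 * B * levy_bound \<alpha> z)"
    using levy_quot_le[OF w w' B] by (auto intro!: order_trans[OF _ abs_ge_self])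
qed

text \<open>Differentiation under the integral sign, followed by the fundamental theorem of
  calculus. Together they make the derivative of a window integral an increment of \<open>w\<close>,
  bounded as soon as \<open>w\<close> is.\<close>

lemma has_derivative_window:
  fixes w :: "real \<Rightarrow> real"
  assumes w: "\<And>y. (w has_real_derivative w' y) (at y)" and w': "continuous_on UNIV w'" and h: "0 \<le> h"
  shows "((\<lambda>y. integral {0..h} (\<lambda>s. w (y + s))) has_real_derivative integral {0..h} (\<lambda>s. w' (x + s))) (at x)"
    and "integral {0..h} (\<lambda>s. w' (x + s)) = w (x + h) - w x"
proof -
  have cw: "continuous_on UNIV w"
    using w by (intro continuous_at_imp_continuous_on) (blast intro: DERIV_isCont)
  have *: "((\<lambda>y. integral (cbox 0 h) (\<lambda>s. w (y + s))) has_field_derivative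
     integral (cbox 0 h) (\<lambda>s. w' (x + s))) (at x within UNIV)"
  proof (rule leibniz_rule_field_derivative[of UNIV])
    show "((\<lambda>y. w (y + s)) has_field_derivative w' (y + s)) (at y within UNIV)" for y s
      using w[of "y + s"] by (simp only: DERIV_shift)
    show "(\<lambda>s. w (y + s)) integrable_on cbox 0 h" for y
      by (intro integrable_continuous continuous_on_compose2[OF cw]) (auto intro!: continuous_intros)
    show "continuous_on (UNIV \<times> cbox 0 h) (\<lambda>(y, s). w' (y + s))"
      unfolding case_prod_unfold
      by (intro continuous_on_compose2[OF w']) (auto intro!: continuous_intros)
  qed auto
  then show "((\<lambda>y. integral {0..h} (\<lambda>s. w (y + s))) has_real_derivative integral {0..h} (\<lambda>s. w' (x + s))) (at x)"
    by simp
  have "((\<lambda>s. w' (x + s)) has_integral w (x + h) - w (x + 0)) {0..h}"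
  proof (rule fundamental_theorem_of_calculus[OF h])
    show "((\<lambda>s. w (x + s)) has_vector_derivative w' (x + s)) (at s within {0..h})" for s
      unfolding has_real_derivative_iff_has_vector_derivative[symmetric]
    proof (rule DERIV_subset)
      show "((\<lambda>s. w (x + s)) has_real_derivative w' (x + s)) (at s)"
        using w[of "s + x"] by (simp only: DERIV_shift add.commute[of x])
    qed simp
  qed
  then show "integral {0..h} (\<lambda>s. w' (x + s)) = w (x + h) - w x"
    using integral_unique by auto
qed

text \<open>Fubini's theorem for the integrals in \<open>s\<close> and \<open>z\<close>: the joint
  integrand \<open>J\<close> is dominated by the indicator of the window times a multiple of
  \<open>levy_bound \<alpha>\<close>.\<close>

lemma frac_lap_window:
  assumes \<alpha>: "1 < \<alpha>" "\<alpha> < 2"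
    and w: "\<And>y. (w has_real_derivative w' y) (at y)"
    and w': "\<And>y. (w' has_real_derivative w'' y) (at y)"
    and B: "\<And>y. \<bar>w' y\<bar> \<le> B" "\<And>y. \<bar>w'' y\<bar> \<le> B"
    and h: "0 \<le> h"
  shows "((\<lambda>s. frac_lap \<alpha> w (x + s)) has_integral
           frac_lap \<alpha> (\<lambda>y. integral {0..h} (\<lambda>s. w (y + s))) x) {0..h}"
proof -
  have cw: "continuous_on UNIV w" and cw': "continuous_on UNIV w'"
    using w w' by (auto intro!: continuous_at_imp_continuous_on intro: DERIV_isCont)
  have [measurable]: "w \<in> borel_measurable borel" "w' \<in> borel_measurable borel"
    using cw cw' by (auto intro: borel_measurable_continuous_onI)
  have B0: "0 \<le> B" using B(1)[of 0] by linarith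
  have dw: "deriv w y = w' y" for y using w by (rule DERIV_imp_deriv)
  define W where "W = (\<lambda>y. integral {0..h} (\<lambda>s. w (y + s)))"
  have dW: "deriv W y = integral {0..h} (\<lambda>s. w' (y + s))" for y
    unfolding W_def by (intro DERIV_imp_deriv has_derivative_window w cw' h)
  define J where "J = (\<lambda>s z. indicator {0..h} s * levy_quot \<alpha> w (x + s) z)"
  have J_le: "\<bar>J s z\<bar> \<le> indicator {0..h} s * (2 * B * levy_bound \<alpha> z)" for s z
    using levy_quot_le[OF w w' B] by (auto simp: J_def indicator_def)
  have [measurable]: "case_prod J \<in> borel_measurable (lborel \<Otimes>\<^sub>M lborel)"
    unfolding J_def levy_quot_def dw by measurable
  have Jz: "integrable lborel (J s)" for s
    unfolding J_def using integrable_levy_quot[OF \<alpha> w w' B] by (rule integrable_mult_right)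
  have IJ: "integrable lborel (\<lambda>s. LINT z|lborel. norm (J s z))"
  proof (rule Bochner_Integration.integrable_bound)
    show "integrable lborel (\<lambda>s. indicator {0..h} s * (LINT z|lborel. 2 * B * levy_bound \<alpha> z) :: real)"
      by (intro integrable_mult_left integrable_real_indicator)
        (auto simp: emeasure_lborel_Icc_eq split: if_splits)
    show "(\<lambda>s. LINT z|lborel. norm (J s z)) \<in> borel_measurable lborel"
      by measurable
    have "(LINT z|lborel. norm (J s z)) \<le> (LINT z|lborel. indicator {0..h} s * (2 * B * levy_bound \<alpha> z))" for s
      using J_le Jz integrable_levy_bound[OF \<alpha>] by (intro integral_mono) auto
    then show "AE s in lborel. norm (LINT z|lborel. norm (J s z)) \<le>
        norm (indicator {0..h} s * (LINT z|lborel. 2 * B * levy_bound \<alpha> z) :: real)"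
      by (auto simp: integral_nonneg_AE intro!: order_trans[OF _ abs_ge_self])
  qed
  have int: "integrable (lborel \<Otimes>\<^sub>M lborel) (case_prod J)"
    using IJ Jz by (intro lborel_pair.Fubini_integrable) auto
  have Js: "(LINT s|lborel. J s z) = levy_quot \<alpha> W x z" for z
  proof -
    have ii: "(\<lambda>s. w (y + s)) integrable_on {0..h}" "(\<lambda>s. w' (y + s)) integrable_on {0..h}" for y
      by (intro integrable_continuous_real continuous_on_compose2[OF cw] continuous_on_compose2[OF cw'];
          auto intro!: continuous_intros)+
    have c: "continuous_on {0..h} (\<lambda>s. levy_quot \<alpha> w (x + s) z)"
      unfolding levy_quot_def dw divide_inverse
      by (intro continuous_intros continuous_on_compose2[OF cw] continuous_on_compose2[OF cw']) auto
    have "(LINT s|lborel. J s z) = (LINT s:{0..h}|lborel. levy_quot \<alpha> w (x + s) z)"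
      by (simp add: J_def set_lebesgue_integral_def)
    also have "\<dots> = integral {0..h} (\<lambda>s. levy_quot \<alpha> w (x + s) z)"
      using c by (intro set_borel_integral_eq_integral borel_integrable_atLeastAtMost')
    also have "((\<lambda>s. levy_quot \<alpha> w (x + s) z) has_integral levy_quot \<alpha> W x z) {0..h}"
    proof -
      have "((\<lambda>s. (w (x + z + s) - w (x + s) - w' (x + s) * z) / \<bar>z\<bar> powr (1 + \<alpha>)) has_integral
          (W (x + z) - W x - integral {0..h} (\<lambda>s. w' (x + s)) * z) / \<bar>z\<bar> powr (1 + \<alpha>)) {0..h}"
        unfolding W_def
        by (intro has_integral_divide has_integral_diff has_integral_mult_left integrable_integral ii)
      then show ?thesis
        unfolding levy_quot_def dw dW by (simp only: add.assoc add.commute[of z])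
    qed
    then have "integral {0..h} (\<lambda>s. levy_quot \<alpha> w (x + s) z) = levy_quot \<alpha> W x z"
      by (rule integral_unique)
    finally show ?thesis .
  qed
  have "(LINT s|lborel. (LINT z|lborel. J s z)) = (LINT z|lborel. levy_quot \<alpha> W x z)"
    using lborel_pair.Fubini_integral[OF int] by (simp add: Js)
  moreover have "integrable lborel (\<lambda>s. LINT z|lborel. J s z)"
    using lborel_pair.integrable_fst[OF int] by simp
  ultimately have "set_integrable lborel {0..h} (\<lambda>s. LINT z|lborel. levy_quot \<alpha> w (x + s) z)"
    and "(LINT s:{0..h}|lborel. (LINT z|lborel. levy_quot \<alpha> w (x + s) z)) = (LINT z|lborel. levy_quot \<alpha> W x z)"
    by (simp_all add: J_def set_integrable_def set_lebesgue_integral_def)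
  then have "((\<lambda>s. LINT z|lborel. levy_quot \<alpha> w (x + s) z) has_integral
       (LINT z|lborel. levy_quot \<alpha> W x z)) {0..h}"
    using set_borel_integral_eq_integral by (metis has_integral_integrable_integral)
  then show ?thesis
    unfolding frac_lap_levy_quot W_def[symmetric] by (rule has_integral_mult_right)
qed

lemma levy_quot_cmult:
  assumes "w differentiable (at x)"
  shows "levy_quot \<alpha> (\<lambda>y. c * w y) x z = c * levy_quot \<alpha> w x z"
proof -
  have "deriv (\<lambda>y. c * w y) x = c * deriv w x"
    using assms by (intro DERIV_imp_deriv DERIV_cmult) (simp add: DERIV_deriv_iff_real_differentiable)
  then show ?thesis by (simp add: levy_quot_def algebra_simps)
qed

lemma frac_lap_cmult:
  assumes "w differentiable (at x)"
  shows "frac_lap \<alpha> (\<lambda>y. c * w y) x = c * frac_lap \<alpha> w x"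
  unfolding frac_lap_levy_quot levy_quot_cmult[OF assms] by simp

section \<open>From pointwise limits and integrals to uniform and pointwise bounds\<close>

text \<open>Convergence is used at the finitely many points of a \<delta>-net only; the common
  Lipschitz constant carries the bound from the net to all of \<open>K\<close> at the cost of half
  of \<eta>.\<close>

lemma eventually_uniformly_le:
  fixes F :: "'a::metric_space \<Rightarrow> 'b \<Rightarrow> real"
  assumes K: "compact K"
    and lip: "\<forall>\<^sub>F t in A. \<forall>p\<in>K. \<forall>q\<in>K. \<bar>F p t - F q t\<bar> \<le> C * dist p q"
    and lim: "\<And>p. p \<in> K \<Longrightarrow> (F p \<longlongrightarrow> F0 p) A"
    and le: "\<And>p. p \<in> K \<Longrightarrow> F0 p \<le> k" and \<eta>: "0 < \<eta>"
  shows "\<forall>\<^sub>F t in A. \<forall>p\<in>K. F p t \<le> k + \<eta>"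
proof -
  define \<delta> where "\<delta> = \<eta> / 2 / (\<bar>C\<bar> + 1)"
  have \<delta>: "\<delta> > 0" using \<eta> by (simp add: \<delta>_def)
  obtain N where N: "finite N" "N \<subseteq> K" "K \<subseteq> (\<Union>p\<in>N. ball p \<delta>)"
    using seq_compact_imp_totally_bounded[OF K[unfolded compact_eq_seq_compact_metric]] \<delta> by metis
  have "\<forall>\<^sub>F t in A. \<forall>p\<in>N. F p t < k + \<eta> / 2"
  proof (intro eventually_ball_finite N(1) ballI)
    fix p assume "p \<in> N"
    then have p: "p \<in> K" using N(2) by blast
    show "\<forall>\<^sub>F t in A. F p t < k + \<eta> / 2"
      using le[OF p] \<eta> by (intro order_tendstoD(2)[OF lim[OF p]]) linarith
  qed
  with lip show ?thesis
  proof eventually_elim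
    case (elim t)
    show ?case
    proof
      fix p assume p: "p \<in> K"
      then obtain q where q: "q \<in> N" "dist q p < \<delta>" using N(3) by auto
      have "\<bar>F p t - F q t\<bar> \<le> C * dist p q" using elim p q N(2) by blast
      also have "\<dots> \<le> (\<bar>C\<bar> + 1) * \<delta>"
        using q(2) \<delta> by (intro mult_mono) (auto simp: dist_commute)
      also have "\<dots> = \<eta> / 2"
      proof -
        have "\<bar>C\<bar> + 1 \<noteq> 0" by linarith
        then show ?thesis unfolding \<delta>_def by (metis nonzero_mult_div_cancel_left times_divide_eq_right)
      qed
      finally have "\<bar>F p t - F q t\<bar> \<le> \<eta> / 2" .
      moreover have "F q t < k + \<eta> / 2" using elim q(1) by blast
      ultimately show "F p t \<le> k + \<eta>" using \<eta> by linarith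
    qed
  qed
qed

text \<open>Recovers a bound at a point from windows of every length: if \<open>q 0\<close> exceeded
  \<open>k\<close>, continuity would keep \<open>q\<close> above the midpoint \<open>m\<close> on a
  short interval.\<close>

lemma le_of_integral_le:
  fixes q :: "real \<Rightarrow> real"
  assumes q: "continuous_on UNIV q" and le: "\<And>h. 0 < h \<Longrightarrow> integral {0..h} q \<le> k * h"
  shows "q 0 \<le> k"
proof (rule ccontr)
  assume neg: "\<not> q 0 \<le> k"
  define m where "m = (q 0 + k) / 2"
  have m: "k < m" "m < q 0" using neg by (auto simp: m_def)
  have "isCont q 0" using q by (simp add: continuous_on_eq_continuous_at)
  then have "\<forall>\<^sub>F s in at 0. q s > m"
    using m(2) unfolding isCont_def by (rule order_tendstoD)
  then obtain d where d: "d > 0" "\<And>s. s \<noteq> 0 \<Longrightarrow> dist s 0 < d \<Longrightarrow> q s > m"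
    unfolding eventually_at by auto
  have "m * (d / 2) = integral {0..d/2} (\<lambda>_. m)" using d(1) by simp
  also have "\<dots> \<le> integral {0..d/2} q"
  proof (rule integral_le)
    show "q integrable_on {0..d/2}"
      using continuous_on_subset[OF q] by (intro integrable_continuous_real) auto
    show "m \<le> q s" if "s \<in> {0..d/2}" for s
      using that d(1) d(2)[of s] m(2) by (cases "s = 0") (auto simp: dist_real_def intro: less_imp_le)
  qed auto
  also have "\<dots> \<le> k * (d / 2)" using le[of "d/2"] d(1) by simp
  finally show False using m(1) d(1) by simp
qed

section \<open>Window integrals of bounded functions\<close>

definition window :: "real \<Rightarrow> (real \<Rightarrow> real \<Rightarrow> real) \<Rightarrow> real \<Rightarrow> real \<Rightarrow> real" where
  "window h u x t = integral {0..h} (\<lambda>s. u (x + s) t)"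

lemma lint_times_indicator_shift:
  fixes v :: "real \<Rightarrow> real"
  shows "(LINT y|lborel. v y * indicator {x..x + h} y) = (LINT s|lborel. v (x + s) * indicator {0..h} s)"
proof -
  have "indicator {x..x + h} (x + s) = (indicator {0..h} s :: real)" for s
    by (auto simp: indicator_def)
  then show ?thesis
    using lborel_integral_real_affine[of 1 "\<lambda>y. v y * indicator {x..x + h} y" x] by simp
qed

text \<open>Links the Lebesgue integral against a test function, in which the initial condition is
  phrased, with the gauge integral used in \<open>window\<close>.\<close>

lemma lint_times_indicator:
  fixes v :: "real \<Rightarrow> real"
  assumes "continuous_on UNIV v"
  shows "(LINT y|lborel. v y * indicator {x..x + h} y) = integral {0..h} (\<lambda>s. v (x + s))"
proof -
  have "continuous_on {0..h} (\<lambda>s. v (x + s))"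
    by (intro continuous_on_compose2[OF assms]) (auto intro!: continuous_intros)
  then have "(LINT s:{0..h}|lborel. v (x + s)) = integral {0..h} (\<lambda>s. v (x + s))"
    by (intro set_borel_integral_eq_integral borel_integrable_atLeastAtMost')
  then show ?thesis
    unfolding lint_times_indicator_shift by (simp add: set_lebesgue_integral_def mult.commute)
qed

lemma integrable_times_indicator:
  fixes v :: "real \<Rightarrow> real"
  assumes [measurable]: "v \<in> borel_measurable borel" and N: "\<And>y. \<bar>v y\<bar> \<le> N"
  shows "integrable lborel (\<lambda>s. v (x + s) * indicator {0..h} s)"
proof (rule Bochner_Integration.integrable_bound)
  show "integrable lborel (\<lambda>s. N * indicator {0..h} s)"
    by (intro integrable_mult_right integrable_real_indicator)
      (auto simp: emeasure_lborel_Icc_eq split: if_splits)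
  show "AE s in lborel. norm (v (x + s) * indicator {0..h} s) \<le> norm (N * indicator {0..h} s)"
    using N order_trans[OF N abs_ge_self] by (auto simp: indicator_def)
qed measurable

text \<open>Only measurability and boundedness are assumed because the initial datum may jump. The
  factor \<sigma> treats both signs at once: -1 serves monotonicity, 1 the oscillation.\<close>

lemma lint_window_increment_le:
  fixes v :: "real \<Rightarrow> real"
  assumes v: "v \<in> borel_measurable borel" "\<And>y. \<bar>v y\<bar> \<le> N"
    and inc: "\<And>y. \<sigma> * (v (y + a) - v y) \<le> k" and h: "0 \<le> h"
  shows "\<sigma> * ((LINT y|lborel. v y * indicator {x + a..x + a + h} y)
           - (LINT y|lborel. v y * indicator {x..x + h} y)) \<le> k * h"
proof -
  note I = integrable_times_indicator[OF v]
  have "\<sigma> * ((LINT y|lborel. v y * indicator {x + a..x + a + h} y)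
           - (LINT y|lborel. v y * indicator {x..x + h} y))
      = (LINT s|lborel. \<sigma> * (v (x + a + s) * indicator {0..h} s - v (x + s) * indicator {0..h} s))"
    unfolding lint_times_indicator_shift using I[of "x + a" h] I[of x h] by simp
  also have "\<dots> \<le> (LINT s|lborel. k * indicator {0..h} s)"
  proof (rule integral_mono)
    show "integrable lborel (\<lambda>s. k * indicator {0..h} s)"
      by (intro integrable_mult_right integrable_real_indicator)
        (auto simp: emeasure_lborel_Icc_eq split: if_splits)
    show "\<sigma> * (v (x + a + s) * indicator {0..h} s - v (x + s) * indicator {0..h} s) \<le> k * indicator {0..h} s" for s
      using inc[of "x + s"] by (auto simp: indicator_def ac_simps)
  qed (intro integrable_mult_right Bochner_Integration.integrable_diff I)
  also have "\<dots> = k * h" using h by simp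
  finally show ?thesis .
qed

section \<open>Regularity of the solution at positive times\<close>

context
  fixes \<alpha> :: real and u0 :: "real \<Rightarrow> real" and u :: "real \<Rightarrow> real \<Rightarrow> real"
  assumes \<alpha>: "1 < \<alpha>" "\<alpha> < 2" and sol: "is_solution \<alpha> u0 u"
begin

lemma solution_Cb:
  assumes "0 < a" "a < T"
  shows "Cb_on (UNIV \<times> {a<..<T}) (iter_pd ds u)"
  using sol assms unfolding is_solution_def Cb_inf_on_def by auto

lemma solution_differentiable:
  assumes "0 < t"
  shows "(\<lambda>y. iter_pd ds u y t) differentiable (at x)"
    and "(\<lambda>s. iter_pd ds u x s) differentiable (at t)"
proof -
  have "Cb_inf_on (UNIV \<times> {t/2<..<2*t}) u"
    using sol assms unfolding is_solution_def by auto
  then show "(\<lambda>y. iter_pd ds u y t) differentiable (at x)"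
    "(\<lambda>s. iter_pd ds u x s) differentiable (at t)"
    using assms unfolding Cb_inf_on_def by force+
qed

lemma solution_derivs:
  assumes "0 < t"
  shows "((\<lambda>y. u y t) has_real_derivative pdx u x t) (at x)"
    and "((\<lambda>y. pdx u y t) has_real_derivative pdx (pdx u) x t) (at x)"
    and "((\<lambda>s. u x s) has_real_derivative pdt u x t) (at t)"
  using solution_differentiable(1)[OF assms, of "[]" x] solution_differentiable(1)[OF assms, of "[True]" x]
    solution_differentiable(2)[OF assms, of "[]" x]
  by (simp_all add: pdx_def pdt_def DERIV_deriv_iff_real_differentiable)

lemma solution_eq:
  assumes "0 < t"
  shows "pdt u x t + frac_lap \<alpha> (\<lambda>y. u y t) x + u x t * pdx u x t = 0"
proof -
  have "0 < t + 1" "t \<in> {0<..<t + 1}" using assms by auto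
  then show ?thesis using sol unfolding is_solution_def by blast
qed

lemma solution_bounded:
  assumes "0 < T"
  obtains M where "\<And>x t. t \<in> {0<..<T} \<Longrightarrow> \<bar>u x t\<bar> \<le> M"
proof -
  have "bounded ((\<lambda>(x,t). u x t) ` (UNIV \<times> {0<..<T}))"
    using sol assms unfolding is_solution_def Cb_on_def by blast
  then obtain M where "\<And>p. p \<in> UNIV \<times> {0<..<T} \<Longrightarrow> norm ((\<lambda>(x,t). u x t) p) \<le> M"
    unfolding bounded_iff by blast
  then show ?thesis using that[of M] by force
qed

lemma solution_deriv_bounded:
  assumes "0 < a" "a < T"
  obtains B where "\<And>x t. t \<in> {a<..<T} \<Longrightarrow> \<bar>pdx u x t\<bar> \<le> B"
    "\<And>x t. t \<in> {a<..<T} \<Longrightarrow> \<bar>pdx (pdx u) x t\<bar> \<le> B"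
proof -
  have "\<exists>B. \<forall>p\<in>UNIV \<times> {a<..<T}. norm ((\<lambda>(x,t). iter_pd ds u x t) p) \<le> B" for ds
    using solution_Cb[OF assms, of ds] unfolding Cb_on_def bounded_iff by blast
  from this[of "[True]"] this[of "[True, True]"] obtain B1 B2
    where "\<And>x t. t \<in> {a<..<T} \<Longrightarrow> \<bar>pdx u x t\<bar> \<le> B1"
      "\<And>x t. t \<in> {a<..<T} \<Longrightarrow> \<bar>pdx (pdx u) x t\<bar> \<le> B2" by force
  then show ?thesis using that[of "max B1 B2"] by (meson max.coboundedI1 max.coboundedI2)
qed

lemma solution_continuous:
  assumes "0 < T"
  shows "continuous_on (UNIV \<times> {0<..<T}) (\<lambda>(x,t). u x t)"
  using sol assms unfolding is_solution_def Cb_on_def by blast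

lemma solution_continuous_x: "0 < t \<Longrightarrow> continuous_on UNIV (\<lambda>y. u y t)"
  using solution_derivs(1) by (auto intro!: continuous_at_imp_continuous_on intro: DERIV_isCont)

lemma solution_continuous_pdx: "0 < t \<Longrightarrow> continuous_on UNIV (\<lambda>y. pdx u y t)"
  using solution_derivs(2) by (auto intro!: continuous_at_imp_continuous_on intro: DERIV_isCont)

section \<open>Window integrals of the solution\<close>

lemma window_dx:
  assumes "0 < t" "0 \<le> h"
  shows "((\<lambda>y. window h u y t) has_real_derivative u (x + h) t - u x t) (at x)"
  using has_derivative_window(1)[OF solution_derivs(1)[OF assms(1)] solution_continuous_pdx[OF assms(1)] assms(2), of x]
  unfolding has_derivative_window(2)[OF solution_derivs(1)[OF assms(1)] solution_continuous_pdx[OF assms(1)] assms(2)]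
  by (simp add: window_def)

lemma window_dt:
  assumes t: "0 < t"
  shows "((\<lambda>s. window h u x s) has_real_derivative integral {0..h} (\<lambda>s. pdt u (x + s) t)) (at t)"
proof -
  have c: "continuous_on (UNIV \<times> {t/2<..<2*t}) (\<lambda>(x,t). pdt u x t)"
    using solution_Cb[of "t/2" "2*t" "[False]"] t by (simp add: Cb_on_def)
  have "((\<lambda>t. integral (cbox 0 h) (\<lambda>s. u (x + s) t)) has_field_derivative
     integral (cbox 0 h) (\<lambda>s. pdt u (x + s) t)) (at t within {t/2<..<2*t})"
  proof (rule leibniz_rule_field_derivative)
    show "((\<lambda>t. u (x + s) t) has_field_derivative pdt u (x + s) r) (at r within {t/2<..<2*t})"
      if "r \<in> {t/2<..<2*t}" for r s
      using that t by (intro has_field_derivative_at_within[OF solution_derivs(3)]) auto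
    show "(\<lambda>s. u (x + s) r) integrable_on cbox 0 h" if "r \<in> {t/2<..<2*t}" for r
      using that t
      by (intro integrable_continuous continuous_on_compose2[OF solution_continuous_x[of r]])
        (auto intro!: continuous_intros)
    have "continuous_on ({t/2<..<2*t} \<times> cbox 0 h) (\<lambda>p. (\<lambda>(x,t). pdt u x t) (x + snd p, fst p))"
      by (rule continuous_on_compose2[OF c]) (auto intro!: continuous_intros)
    then show "continuous_on ({t/2<..<2*t} \<times> cbox 0 h) (\<lambda>(r, s). pdt u (x + s) r)"
      by (simp add: case_prod_unfold)
  qed (use t in auto)
  then show ?thesis
    using t at_within_open[of t "{t/2<..<2*t}"] by (simp add: window_def)
qed

lemma window_continuous:
  assumes "0 < T"
  shows "continuous_on (UNIV \<times> {0<..<T}) (\<lambda>(x,t). window h u x t)"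
proof -
  have "continuous_on ((UNIV \<times> {0<..<T}) \<times> cbox 0 h) (\<lambda>q. (\<lambda>(x,t). u x t) (fst (fst q) + snd q, snd (fst q)))"
    by (rule continuous_on_compose2[OF solution_continuous[OF assms]]) (auto intro!: continuous_intros)
  then have "continuous_on ((UNIV \<times> {0<..<T}) \<times> cbox 0 h) (\<lambda>(p, s). u (fst p + s) (snd p))"
    by (simp add: case_prod_unfold)
  from integral_continuous_on_param[OF this] show ?thesis
    by (simp add: window_def case_prod_unfold)
qed

text \<open>Integrating the equation over a window turns the nonlinearity into a drift with bounded
  coefficient, so that no bound on the space derivative of the solution is needed near time 0.\<close>

lemma window_eq:
  assumes t: "0 < t" and h: "0 \<le> h"
  shows "pdt (window h u) x t + frac_lap \<alpha> (\<lambda>y. window h u y t) x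
    + (u (x + h) t + u x t) / 2 * pdx (window h u) x t = 0"
proof -
  obtain B where B: "\<And>x r. r \<in> {t/2<..<2*t} \<Longrightarrow> \<bar>pdx u x r\<bar> \<le> B"
    "\<And>x r. r \<in> {t/2<..<2*t} \<Longrightarrow> \<bar>pdx (pdx u) x r\<bar> \<le> B"
    using solution_deriv_bounded[of "t/2" "2*t"] t by auto
  have *: "((\<lambda>s. frac_lap \<alpha> (\<lambda>y. u y t) (x + s)) has_integral frac_lap \<alpha> (\<lambda>y. window h u y t) x) {0..h}"
    unfolding window_def using t h
    by (intro frac_lap_window[OF \<alpha>, of _ "\<lambda>y. pdx u y t" "\<lambda>y. pdx (pdx u) y t" B]) (auto intro!: solution_derivs B)
  have "((\<lambda>s. u (x + s) t * pdx u (x + s) t) has_integral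
      (u (x + h) t)\<^sup>2 / 2 - (u (x + 0) t)\<^sup>2 / 2) {0..h}"
  proof (rule fundamental_theorem_of_calculus[OF h])
    fix s
    have "((\<lambda>s. u (x + s) t) has_real_derivative pdx u (x + s) t) (at s)"
      using solution_derivs(1)[OF t, of "s + x"] by (simp only: DERIV_shift add.commute[of x])
    then have "((\<lambda>s. (u (x + s) t)\<^sup>2 / 2) has_real_derivative u (x + s) t * pdx u (x + s) t) (at s)"
      by (auto intro!: derivative_eq_intros)
    then show "((\<lambda>s. (u (x + s) t)\<^sup>2 / 2) has_vector_derivative u (x + s) t * pdx u (x + s) t) (at s within {0..h})"
      unfolding has_real_derivative_iff_has_vector_derivative[symmetric] by (rule DERIV_subset) simp
  qed
  from has_integral_neg[OF has_integral_add[OF * this]]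
  have "((\<lambda>s. pdt u (x + s) t) has_integral
      - (frac_lap \<alpha> (\<lambda>y. window h u y t) x + ((u (x + h) t)\<^sup>2 / 2 - (u (x + 0) t)\<^sup>2 / 2))) {0..h}"
  proof (rule has_integral_eq[rotated])
    show "- (frac_lap \<alpha> (\<lambda>y. u y t) (x + s) + u (x + s) t * pdx u (x + s) t) = pdt u (x + s) t" for s
      using solution_eq[OF t, of "x + s"] by linarith
  qed
  then have "pdt (window h u) x t =
      - (frac_lap \<alpha> (\<lambda>y. window h u y t) x + ((u (x + h) t)\<^sup>2 / 2 - (u (x + 0) t)\<^sup>2 / 2))"
    using DERIV_imp_deriv[OF window_dt[OF t]] by (simp add: pdt_def integral_unique)
  moreover have "pdx (window h u) x t = u (x + h) t - u x t"
    using DERIV_imp_deriv[OF window_dx[OF t h]] by (simp add: pdx_def)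
  \<comment> \<open>The integrated nonlinearity is a difference of half squares; it factors into the
    mean of the end values, which is the drift, times the increment, which is the space derivative
    of the window integral.\<close>
  moreover have "(u (x + h) t + u x t) / 2 * (u (x + h) t - u x t) = (u (x + h) t)\<^sup>2 / 2 - (u x t)\<^sup>2 / 2"
    by (simp add: field_simps power2_eq_square)
  ultimately show ?thesis by (simp add: diff_divide_distrib)
qed

lemma window_le:
  assumes "0 < t" "0 \<le> h" and M: "\<And>x. \<bar>u x t\<bar> \<le> M"
  shows "\<bar>window h u x t\<bar> \<le> M * h"
proof -
  have "norm (integral {0..h} (\<lambda>s. u (x + s) t)) \<le> M * (h - 0)"
    using M assms
    by (intro integral_bound continuous_on_compose2[OF solution_continuous_x[of t]])
      (auto intro!: continuous_intros)
  then show ?thesis using assms by (simp add: window_def)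
qed

text \<open>The indicator of a bounded interval is an admissible test function for the weak-*
  convergence.\<close>

lemma window_tendsto:
  assumes "0 \<le> h"
  shows "((\<lambda>t. window h u x t) \<longlongrightarrow> (LINT y|lborel. u0 y * indicator {x..x + h} y)) (at_right 0)"
proof -
  have "integrable lborel (indicator {x..x + h} :: real \<Rightarrow> real)"
    by (intro integrable_real_indicator) (auto simp: emeasure_lborel_Icc_eq split: if_splits)
  then have "((\<lambda>t. LINT y|lborel. u y t * indicator {x..x + h} y) \<longlongrightarrow>
      (LINT y|lborel. u0 y * indicator {x..x + h} y)) (at_right 0)"
    using sol unfolding is_solution_def by blast
  moreover have "\<forall>\<^sub>F t in at_right 0. (LINT y|lborel. u y t * indicator {x..x + h} y) = window h u x t"
    using eventually_at_right_less[of 0]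
    by eventually_elim (simp add: lint_times_indicator[OF solution_continuous_x] window_def)
  ultimately show ?thesis using tendsto_cong by fast
qed

section \<open>Increment bounds for the solution\<close>

text \<open>With the drift regarded as given, the window equation is linear, hence stable under the
  factor \<sigma>, and a constant bound corresponds to \<open>g = 0\<close>, for which the condition
  \<open>super\<close> is trivial. The initial condition follows from pointwise convergence of the
  windows and a Lipschitz constant uniform in time.\<close>

lemma window_increment_le:
  assumes u0: "u0 \<in> borel_measurable borel" "\<And>y. \<bar>u0 y\<bar> \<le> N"
    and inc: "\<And>y a. 0 \<le> a \<Longrightarrow> \<sigma> * (u0 (y + a) - u0 y) \<le> k" and k: "0 \<le> k"
    and h: "0 \<le> h" and t: "0 < t" and a: "0 \<le> a"
  shows "\<sigma> * (window h u (x + a) t - window h u x t) \<le> k * h"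
proof -
  define T where "T = t + 1"
  have T: "0 < T" "t \<in> {0<..<T}" using t by (auto simp: T_def)
  obtain M where M: "\<And>x t. t \<in> {0<..<T} \<Longrightarrow> \<bar>u x t\<bar> \<le> M"
    using solution_bounded[OF T(1)] by blast
  have M0: "0 \<le> M" using M[OF T(2), of 0] by linarith
  define f where "f = (\<lambda>x t. \<sigma> * window h u x t)"
  have df: "((\<lambda>y. f y t) has_real_derivative \<sigma> * (u (x + h) t - u x t)) (at x)" if "0 < t" for x t
    unfolding f_def using window_dx[OF that h] by (rule DERIV_cmult)
  have wdiff: "(\<lambda>y. window h u y t) differentiable (at x)" if "0 < t" for x t
    using window_dx[OF that h] unfolding real_differentiable_def by blast
  have "f (x + a) t - f x t \<le> k * h + a * (\<lambda>_. 0) t"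
  proof (rule two_point_maximum_principle[where T = T and b = "\<lambda>x t. (u (x + h) t + u x t) / 2"
        and g = "\<lambda>_. 0" and g' = "\<lambda>_. 0", OF \<alpha> _ _ _ _ _ _ _ _ _ _ _ _ T(2) a])
    show "continuous_on (UNIV \<times> {0<..<T}) (\<lambda>(x, t). f x t)"
      using window_continuous[OF T(1), of h] unfolding f_def case_prod_unfold by (intro continuous_intros)
    show "\<bar>f x t\<bar> \<le> \<bar>\<sigma>\<bar> * (M * h)" if "t \<in> {0<..<T}" for x t
      unfolding f_def abs_mult using window_le[of t h M x] M that h by (intro mult_left_mono) auto
    show "\<bar>(u (x + h) t + u x t) / 2\<bar> \<le> M" if "t \<in> {0<..<T}" for x t
      using M[OF that, of x] M[OF that, of "x + h"] by (auto simp: abs_le_iff)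
    show "(\<lambda>y. f y t) differentiable (at x)" if "t \<in> {0<..<T}" for x t
      using df[of t x] that by (auto simp: real_differentiable_def)
    show "(\<lambda>s. f x s) differentiable (at t)" if "t \<in> {0<..<T}" for x t
      using DERIV_cmult[OF window_dt, of t \<sigma> h x] that unfolding f_def by (auto simp: real_differentiable_def)
    show "integrable lborel (levy_quot \<alpha> (\<lambda>y. f y t) x)" if "t \<in> {0<..<T}" for x t
    proof -
      \<comment> \<open>The bound \<open>B\<close> may depend on \<open>t\<close>; it only serves
        integrability at this fixed time.\<close>
      have "0 < t/2" "t/2 < T" using that by auto
      then obtain B where B: "\<And>x r. r \<in> {t/2<..<T} \<Longrightarrow> \<bar>pdx u x r\<bar> \<le> B"
        using solution_deriv_bounded[of "t/2" T] by metis
      have t: "0 < t" "t \<in> {t/2<..<T}" using that by auto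
      have B0: "0 \<le> B" using B[OF t(2), of 0] by linarith
      show ?thesis
      proof (rule integrable_levy_quot[OF \<alpha> df[OF t(1)], where B = "\<bar>\<sigma>\<bar> * (2 * M + 2 * B)"])
        have "((\<lambda>y. u (y + h) t) has_real_derivative pdx u (y + h) t) (at y)" for y
          using solution_derivs(1)[OF t(1), of "y + h"] by (simp only: DERIV_shift)
        then show "((\<lambda>y. \<sigma> * (u (y + h) t - u y t)) has_real_derivative
            \<sigma> * (pdx u (y + h) t - pdx u y t)) (at y)" for y
          by (intro DERIV_cmult DERIV_diff solution_derivs t)
        show "\<bar>\<sigma> * (u (y + h) t - u y t)\<bar> \<le> \<bar>\<sigma>\<bar> * (2 * M + 2 * B)" for y
          unfolding abs_mult using M[OF that, of y] M[OF that, of "y + h"] B0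
          by (intro mult_left_mono) linarith+
        show "\<bar>\<sigma> * (pdx u (y + h) t - pdx u y t)\<bar> \<le> \<bar>\<sigma>\<bar> * (2 * M + 2 * B)" for y
          unfolding abs_mult using B[OF t(2), of y] B[OF t(2), of "y + h"] M0
          by (intro mult_left_mono) linarith+
      qed
    qed
    show "pdt f x t + frac_lap \<alpha> (\<lambda>y. f y t) x + (u (x + h) t + u x t) / 2 * pdx f x t = 0"
      if "t \<in> {0<..<T}" for x t
    proof -
      have t: "0 < t" using that by simp
      have "pdt f x t = \<sigma> * pdt (window h u) x t"
        using DERIV_imp_deriv[OF DERIV_cmult[OF window_dt[OF t]]] DERIV_imp_deriv[OF window_dt[OF t]]
        by (simp add: pdt_def f_def)
      moreover have "pdx f x t = \<sigma> * pdx (window h u) x t"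
        using DERIV_imp_deriv[OF df[OF t]] DERIV_imp_deriv[OF window_dx[OF t h]] by (simp add: pdx_def)
      moreover have "frac_lap \<alpha> (\<lambda>y. f y t) x = \<sigma> * frac_lap \<alpha> (\<lambda>y. window h u y t) x"
        unfolding f_def by (rule frac_lap_cmult[OF wdiff[OF t]])
      ultimately show ?thesis
        using arg_cong[OF window_eq[OF t h, of x], of "\<lambda>r. \<sigma> * r"] by (simp add: algebra_simps)
    qed
    show "\<exists>\<tau>>0. \<forall>t\<in>{0<..<\<tau>}. \<forall>x a. \<bar>x\<bar> \<le> R \<longrightarrow> 0 \<le> a \<longrightarrow> a \<le> R \<longrightarrow>
        f (x + a) t - f x t \<le> k * h + a * 0 + \<eta>" if "0 < R" "0 < \<eta>" for R \<eta>
    proof -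
      define F where "F = (\<lambda>p t. f (fst p + snd p) t - f (fst p) t)"
      define W0 where "W0 = (\<lambda>x. LINT y|lborel. u0 y * indicator {x..x + h} y)"
      \<comment> \<open>The constant does not depend on \<open>t\<close>: the space derivative of a
        window is an increment of \<open>u\<close>, and \<open>u\<close> is bounded down to time
        0.\<close>
      have lip: "\<bar>f y t - f z t\<bar> \<le> \<bar>\<sigma>\<bar> * (2 * M) * \<bar>y - z\<bar>" if "t \<in> {0<..<T}" for y z t
      proof -
        have "norm (\<sigma> * (u (x + h) t - u x t)) \<le> \<bar>\<sigma>\<bar> * (2 * M)" for x
          unfolding real_norm_def abs_mult using M[OF that, of x] M[OF that, of "x + h"]
          by (intro mult_left_mono) linarith+
        then have "norm (f y t - f z t) \<le> \<bar>\<sigma>\<bar> * (2 * M) * norm (y - z)"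
          using df[of t] that
          by (intro field_differentiable_bound[of UNIV "\<lambda>y. f y t" "\<lambda>x. \<sigma> * (u (x + h) t - u x t)"]) auto
        then show ?thesis by simp
      qed
      have "\<forall>\<^sub>F t in at_right 0. \<forall>p\<in>{-R..R} \<times> {0..R}. F p t \<le> k * h + \<eta>"
      proof (rule eventually_uniformly_le)
        show "compact ({-R..R} \<times> {0..R})" by (intro compact_Times) auto
        have "\<forall>\<^sub>F t in at_right 0. t \<in> {0<..<T}"
          using T(1) by (rule eventually_at_right_real)
        then show "\<forall>\<^sub>F t in at_right 0. \<forall>p\<in>{-R..R} \<times> {0..R}. \<forall>q\<in>{-R..R} \<times> {0..R}.
            \<bar>F p t - F q t\<bar> \<le> \<bar>\<sigma>\<bar> * (2 * M) * 3 * dist p q"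
        proof eventually_elim
          case (elim t)
          show ?case
          proof (intro ballI)
            fix p q :: "real \<times> real"
            have d: "\<bar>fst p - fst q\<bar> \<le> dist p q" "\<bar>snd p - snd q\<bar> \<le> dist p q"
              using dist_fst_le[of p q] dist_snd_le[of p q] by (simp_all add: dist_real_def)
            have C: "0 \<le> \<bar>\<sigma>\<bar> * (2 * M)" using M0 by simp
            have "\<bar>F p t - F q t\<bar> \<le> \<bar>\<sigma>\<bar> * (2 * M) * \<bar>(fst p + snd p) - (fst q + snd q)\<bar>
                + \<bar>\<sigma>\<bar> * (2 * M) * \<bar>fst p - fst q\<bar>"
              using lip[OF elim, of "fst p + snd p" "fst q + snd q"] lip[OF elim, of "fst p" "fst q"]
              unfolding F_def by linarith
            also have "\<dots> = \<bar>\<sigma>\<bar> * (2 * M) * (\<bar>(fst p + snd p) - (fst q + snd q)\<bar> + \<bar>fst p - fst q\<bar>)"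
              by (simp only: distrib_left)
            \<comment> \<open>The right end point moves by at most twice the distance, the left one
              by at most the distance itself.\<close>
            also have "\<dots> \<le> \<bar>\<sigma>\<bar> * (2 * M) * (3 * dist p q)"
              using C d by (intro mult_left_mono) linarith+
            finally show "\<bar>F p t - F q t\<bar> \<le> \<bar>\<sigma>\<bar> * (2 * M) * 3 * dist p q" by simp
          qed
        qed
        show "(F p \<longlongrightarrow> \<sigma> * (W0 (fst p + snd p) - W0 (fst p))) (at_right 0)" for p
          unfolding F_def f_def W0_def right_diff_distrib
          by (intro tendsto_intros window_tendsto h)
        show "\<sigma> * (W0 (fst p + snd p) - W0 (fst p)) \<le> k * h" if "p \<in> {-R..R} \<times> {0..R}" for p
          unfolding W0_def using that inc
          by (intro lint_window_increment_le[OF u0 _ h]) auto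
      qed (fact \<open>0 < \<eta>\<close>)
      then obtain \<tau> where "\<tau> > 0" "\<And>t. 0 < t \<Longrightarrow> t < \<tau> \<Longrightarrow> \<forall>p\<in>{-R..R} \<times> {0..R}. F p t \<le> k * h + \<eta>"
        unfolding eventually_at_right_field by auto
      then show ?thesis unfolding F_def by (intro exI[of _ \<tau>]) fastforce
    qed
  qed (use k h in auto)
  then show ?thesis by (simp add: f_def right_diff_distrib)
qed

text \<open>The window bound is proportional to \<open>h\<close>, so letting \<open>h\<close> shrink
  recovers the increment, continuous in space at the positive time \<open>t\<close>.\<close>

lemma increment_le:
  assumes u0: "u0 \<in> borel_measurable borel" "\<And>y. \<bar>u0 y\<bar> \<le> N"
    and inc: "\<And>y a. 0 \<le> a \<Longrightarrow> \<sigma> * (u0 (y + a) - u0 y) \<le> k" and k: "0 \<le> k"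
    and t: "0 < t" and a: "0 \<le> a"
  shows "\<sigma> * (u (x + a) t - u x t) \<le> k"
proof -
  have c: "continuous_on A (\<lambda>s. u (y + s) t)" for y A
    by (intro continuous_on_compose2[OF solution_continuous_x[OF t]]) (auto intro!: continuous_intros)
  have "(\<lambda>s. \<sigma> * (u (x + a + s) t - u (x + s) t)) 0 \<le> k"
  proof (rule le_of_integral_le)
    show "continuous_on UNIV (\<lambda>s. \<sigma> * (u (x + a + s) t - u (x + s) t))"
      by (intro continuous_intros c)
    show "integral {0..h} (\<lambda>s. \<sigma> * (u (x + a + s) t - u (x + s) t)) \<le> k * h" if "0 < h" for h
    proof -
      have i: "(\<lambda>s. u (y + s) t) integrable_on {0..h}" for y
        by (intro integrable_continuous_real c)
      have "integral {0..h} (\<lambda>s. \<sigma> * (u (x + a + s) t - u (x + s) t))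
          = \<sigma> * (window h u (x + a) t - window h u x t)"
        unfolding window_def using i by (simp add: integral_diff)
      also have "\<dots> \<le> k * h"
        using that by (intro window_increment_le[OF u0 inc k _ t a]) auto
      finally show ?thesis .
    qed
  qed
  then show ?thesis by simp
qed

text \<open>Starting at a positive time \<open>r\<close> makes the solution Lipschitz there, so that the
  comparison function \<open>a / (t - r)\<close> dominates for \<open>t\<close> close to \<open>r\<close>.\<close>

lemma increment_le_divide:
  assumes t: "0 < t" and a: "0 \<le> a"
  shows "u (x + a) t - u x t \<le> a / t"
proof -
  define T where "T = t + 1"
  have T: "0 < T" "t < T" using t by (auto simp: T_def)
  obtain M where M: "\<And>x t. t \<in> {0<..<T} \<Longrightarrow> \<bar>u x t\<bar> \<le> M"
    using solution_bounded[OF T(1)] by blast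
  have *: "u (x + a) t - u x t \<le> a / (t - r)" if r: "0 < r" "r < t" for r
  proof -
    obtain B where B: "\<And>x t. t \<in> {r/2<..<T} \<Longrightarrow> \<bar>pdx u x t\<bar> \<le> B"
      "\<And>x t. t \<in> {r/2<..<T} \<Longrightarrow> \<bar>pdx (pdx u) x t\<bar> \<le> B"
      using solution_deriv_bounded[of "r/2" T] r T by auto
    have rT: "{r<..<T} \<subseteq> {0<..<T}" "{r<..<T} \<subseteq> {r/2<..<T}" using r by auto
    have "u (x + a) t - u x t \<le> 0 + a * (\<lambda>t. 1 / (t - r)) t"
    proof (rule two_point_maximum_principle[where T = T and b = u and g = "\<lambda>t. 1 / (t - r)"
          and g' = "\<lambda>t. - 1 / (t - r)\<^sup>2" and M = M and N = M, OF \<alpha> _ _ _ _ _ _ _ _ _ _ _ _ _ a])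
      show "continuous_on (UNIV \<times> {r<..<T}) (\<lambda>(x, t). u x t)"
        using rT(1) by (intro continuous_on_subset[OF solution_continuous[OF T(1)]]) auto
      show "(\<lambda>y. u y t) differentiable (at x)" "(\<lambda>s. u x s) differentiable (at t)"
        if "t \<in> {r<..<T}" for x t
        using solution_derivs[of t x] that r by (auto simp: real_differentiable_def)
      show "integrable lborel (levy_quot \<alpha> (\<lambda>y. u y t) x)" if "t \<in> {r<..<T}" for x t
        using that r rT(2) by (intro integrable_levy_quot[OF \<alpha> solution_derivs(1,2), where B = B] B) auto
      show "pdt u x t + frac_lap \<alpha> (\<lambda>y. u y t) x + u x t * pdx u x t = 0" if "t \<in> {r<..<T}" for x t
        using solution_eq that r by auto
      show "((\<lambda>t. 1 / (t - r)) has_real_derivative - 1 / (t - r)\<^sup>2) (at t)" if "t \<in> {r<..<T}" for t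
        using that by (auto intro!: derivative_eq_intros simp: power2_eq_square)
      \<comment> \<open>Here the drift is the solution itself and \<open>g' = - g\<^sup>2\<close>;
        the assumed violation says that the drift increment exceeds \<open>a * g\<close>, which
        compensates \<open>a * g'\<close>.\<close>
      show "0 \<le> a * (- 1 / (t - r)\<^sup>2) + (u (x + a) t - u x t) * (1 / (t - r))"
        if "t \<in> {r<..<T}" "0 < a" "0 + a * (1 / (t - r)) < u (x + a) t - u x t" for x a t
      proof -
        have "a * (1 / (t - r)) * (1 / (t - r)) \<le> (u (x + a) t - u x t) * (1 / (t - r))"
          using that by (intro mult_right_mono) auto
        then show ?thesis by (simp add: power2_eq_square)
      qed
      show "\<exists>\<tau>>r. \<forall>t\<in>{r<..<\<tau>}. \<forall>x a. \<bar>x\<bar> \<le> R \<longrightarrow> 0 \<le> a \<longrightarrow> a \<le> R \<longrightarrow>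
          u (x + a) t - u x t \<le> 0 + a * (1 / (t - r)) + \<eta>" if "0 < R" "0 < \<eta>" for R \<eta>
      \<comment> \<open>Before this time \<open>1 / (t - r)\<close> exceeds the Lipschitz constant
        \<open>B\<close>, and \<open>B\<close> is valid only up to \<open>T\<close>.\<close>
      proof (intro exI[of _ "min T (r + 1 / (\<bar>B\<bar> + 1))"] conjI ballI allI impI)
        show "r < min T (r + 1 / (\<bar>B\<bar> + 1))" using r T by (auto simp: add_nonneg_pos)
        fix t x a assume t: "t \<in> {r<..<min T (r + 1 / (\<bar>B\<bar> + 1))}" and a: "0 \<le> (a::real)"
        have t': "0 < t" "t \<in> {r/2<..<T}" "0 < t - r" "t - r < 1 / (\<bar>B\<bar> + 1)" using t r by auto
        have "norm (u (x + a) t - u x t) \<le> B * norm (x + a - x)"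
          using solution_derivs(1)[OF t'(1)] B(1)[OF t'(2)]
          by (intro field_differentiable_bound[of UNIV "\<lambda>y. u y t" "\<lambda>y. pdx u y t"]) auto
        then have "u (x + a) t - u x t \<le> B * a" using a by simp
        also have "B \<le> 1 / (t - r)"
        proof -
          have "(t - r) * (\<bar>B\<bar> + 1) < 1" using t'(4) by (simp add: field_simps)
          then have "\<bar>B\<bar> + 1 < 1 / (t - r)" using t'(3) by (simp add: field_simps)
          then show ?thesis by linarith
        qed
        then have "B * a \<le> 1 / (t - r) * a" using a by (intro mult_right_mono)
        finally show "u (x + a) t - u x t \<le> 0 + a * (1 / (t - r)) + \<eta>"
          using \<open>0 < \<eta>\<close> by (simp add: mult.commute)
      qed
    qed (use M rT r T in auto)
    then show ?thesis by simp
  qed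
  \<comment> \<open>The bound no longer contains \<open>B\<close>, which depended on
    \<open>r\<close>, so \<open>r\<close> can tend to 0.\<close>
  have "((\<lambda>r. a / (t - r)) \<longlongrightarrow> a / (t - 0)) (at_right 0)"
    using t by (intro tendsto_intros) auto
  moreover have "\<forall>\<^sub>F r in at_right 0. u (x + a) t - u x t \<le> a / (t - r)"
    using eventually_at_right_real[OF t] by eventually_elim (auto intro: *)
  ultimately have "u (x + a) t - u x t \<le> a / (t - 0)"
    by (intro tendsto_lowerbound[of _ _ "at_right 0"]) auto
  then show ?thesis by simp
qed

end

section \<open>Bounds on the derivative for monotone initial data\<close>

theorem theorem2p3:
  fixes \<alpha> c :: real and m :: "real measure"
    and u0 :: "real \<Rightarrow> real" and u :: "real \<Rightarrow> real \<Rightarrow> real"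
  assumes "1 < \<alpha>" "\<alpha> < 2"
    and "sets m = sets borel" "finite_measure m"
    and "\<And>x. u0 x = c + measure m {..x}"
    and "is_solution \<alpha> u0 u"
  shows "(\<forall>x. \<forall>t>0. pdx u x t \<ge> 0)
       \<and> (\<forall>p::real. p \<ge> 1 \<longrightarrow> (\<forall>t>0.
            integrable lborel (\<lambda>x. \<bar>pdx u x t\<bar> powr p) \<and>
            (LINT x|lborel. \<bar>pdx u x t\<bar> powr p) powr (1 / p)
              \<le> t powr (-1 + 1 / p) * measure m UNIV powr (1 / p)))
       \<and> (\<forall>t>0. \<forall>x. \<bar>pdx u x t\<bar> \<le> 1 / t)"
proof -
  note \<alpha> = assms(1,2) and sol = assms(6)
  interpret m: finite_measure m by (fact assms(4))
  define V where "V = measure m UNIV"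
  have V0: "0 \<le> V" by (simp add: V_def)
  have sp: "space m = UNIV" using assms(3) by (metis sets_eq_imp_space_eq space_borel)
  have set_m: "{..x} \<in> sets m" for x :: real using assms(3) by simp
  have le_V: "measure m {..x} \<le> V" for x
    unfolding V_def using m.bounded_measure[of "{..x}"] sp by simp
  have mono: "measure m {..x} \<le> measure m {..y}" if "x \<le> y" for x y
    using that set_m by (intro m.finite_measure_mono) auto
  have u0_mono: "mono u0" using mono by (intro monoI) (simp add: assms(5))
  have u0_meas: "u0 \<in> borel_measurable borel" using u0_mono by (rule borel_measurable_mono)
  have u0_le: "\<bar>u0 y\<bar> \<le> \<bar>c\<bar> + V" for y
    using le_V[of y] measure_nonneg[of m "{..y}"] unfolding assms(5) by linarith
  have incr: "u x t \<le> u (x + a) t" if "0 < t" "0 \<le> a" for x a t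
  proof -
    \<comment> \<open>With \<sigma> equal to -1 and \<open>k = 0\<close> the increment bound becomes
      monotonicity.\<close>
    have "-1 * (u (x + a) t - u x t) \<le> 0"
      using mono by (intro increment_le[OF \<alpha> sol u0_meas u0_le _ _ that]) (auto simp: assms(5))
    then show ?thesis by simp
  qed
  have osc: "u (x + a) t - u x t \<le> V" if "0 < t" "0 \<le> a" for x a t
  proof -
    have "u0 (y + b) - u0 y \<le> V" for y b
      using le_V[of "y + b"] measure_nonneg[of m "{..y}"] unfolding assms(5) by linarith
    then have "1 * (u (x + a) t - u x t) \<le> V"
      using V0 by (intro increment_le[OF \<alpha> sol u0_meas u0_le _ _ that]) auto
    then show ?thesis by simp
  qed
  \<comment> \<open>Increments are controlled for nonnegative \<open>a\<close> only; since the
    derivative exists, the limit from the right determines it.\<close>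
  have quot: "((\<lambda>a. (u (x + a) t - u x t) / a) \<longlongrightarrow> pdx u x t) (at_right 0)" if "0 < t" for x t
    using solution_derivs(1)[OF \<alpha> sol that, of x] unfolding DERIV_def
    by (rule tendsto_mono[rotated]) (simp add: at_le)
  have nonneg: "0 \<le> pdx u x t" if "0 < t" for x t
  proof (rule tendsto_lowerbound[OF quot[OF that]])
    show "\<forall>\<^sub>F a in at_right 0. 0 \<le> (u (x + a) t - u x t) / a"
      using eventually_at_right_less[of 0] by eventually_elim (use incr[OF that] in auto)
  qed simp
  have le_inv: "pdx u x t \<le> 1 / t" if "0 < t" for x t
  proof (rule tendsto_upperbound[OF quot[OF that]])
    show "\<forall>\<^sub>F a in at_right 0. (u (x + a) t - u x t) / a \<le> 1 / t"
      using eventually_at_right_less[of 0]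
    proof eventually_elim
      case (elim a)
      then have "(u (x + a) t - u x t) / a \<le> (a / t) / a"
        using increment_le_divide[OF \<alpha> sol that, of a x] by (intro divide_right_mono) auto
      then show ?case using elim by simp
    qed
  qed simp
  \<comment> \<open>On \<open>{- real n..real n}\<close> the integral of the nonnegative derivative
    is an increment of \<open>u\<close>, at most \<open>V\<close>; monotone convergence passes to
    the whole line.\<close>
  have ux_int: "integrable lborel (\<lambda>x. pdx u x t)" "(LINT x|lborel. pdx u x t) \<le> V" if t: "0 < t" for t
  proof -
    have cont: "continuous_on A (\<lambda>y. pdx u y t)" for A
      using solution_continuous_pdx[OF \<alpha> sol t] by (rule continuous_on_subset) simp
    have [measurable]: "(\<lambda>x. pdx u x t) \<in> borel_measurable borel"
      using cont by (rule borel_measurable_continuous_onI)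
    have "(\<integral>\<^sup>+x. ennreal (pdx u x t) \<partial>lborel) \<le> ennreal V"
    proof -
      have sup: "ennreal (pdx u x t) = (SUP n. ennreal (pdx u x t) * indicator {- real n..real n} x)" for x
      proof (rule antisym)
        obtain n where "\<bar>x\<bar> \<le> real n" using real_arch_simple by blast
        then have "ennreal (pdx u x t) = ennreal (pdx u x t) * indicator {- real n..real n} x"
          by (auto simp: indicator_def)
        then show "ennreal (pdx u x t) \<le> (SUP n. ennreal (pdx u x t) * indicator {- real n..real n} x)"
          by (metis (no_types, lifting) SUP_upper UNIV_I)
        show "(SUP n. ennreal (pdx u x t) * indicator {- real n..real n} x) \<le> ennreal (pdx u x t)"
          by (intro SUP_least) (auto simp: indicator_def)
      qed
      have "(\<integral>\<^sup>+x. ennreal (pdx u x t) \<partial>lborel)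
          = (SUP n. \<integral>\<^sup>+x. ennreal (pdx u x t) * indicator {- real n..real n} x \<partial>lborel)"
      proof (subst sup, rule nn_integral_monotone_convergence_SUP)
        show "incseq (\<lambda>n x. ennreal (pdx u x t) * indicator {- real n..real n} x)"
          by (auto simp: incseq_def le_fun_def indicator_def)
      qed measurable
      also have "\<dots> \<le> ennreal V"
      proof (rule SUP_least)
        fix n
        have "(\<integral>\<^sup>+x. ennreal (pdx u x t) * indicator {- real n..real n} x \<partial>lborel)
            = ennreal (u (real n) t - u (- real n) t)"
          by (rule nn_integral_FTC_Icc)
            (auto intro: nonneg[OF t] has_field_derivative_at_within[OF solution_derivs(1)[OF \<alpha> sol t]])
        also have "\<dots> \<le> ennreal V"
          using osc[OF t, of "2 * real n" "- real n"] by (intro ennreal_leI) simp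
        finally show "(\<integral>\<^sup>+x. ennreal (pdx u x t) * indicator {- real n..real n} x \<partial>lborel) \<le> ennreal V" .
      qed
      finally show ?thesis .
    qed
    note le = this
    show int: "integrable lborel (\<lambda>x. pdx u x t)"
      using nonneg[OF t] le by (intro integrableI_nonneg) (auto intro: le_less_trans)
    show "(LINT x|lborel. pdx u x t) \<le> V"
      using le nonneg[OF t] V0 nn_integral_eq_integral[OF int] by simp
  qed
  have Lp: "integrable lborel (\<lambda>x. \<bar>pdx u x t\<bar> powr p) \<and>
      (LINT x|lborel. \<bar>pdx u x t\<bar> powr p) powr (1 / p) \<le> t powr (-1 + 1 / p) * V powr (1 / p)"
    if p: "1 \<le> p" and t: "0 < t" for p t
  proof -
    \<comment> \<open>Interpolation: \<open>p - 1\<close> of the \<open>p\<close> factors are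
      bounded by \<open>1 / t\<close>, and one is kept for integration. At zeros of the derivative
      both sides are 0, as \<open>0 powr p = 0\<close>.\<close>
    have le: "\<bar>pdx u x t\<bar> powr p \<le> t powr (1 - p) * pdx u x t" for x
    proof (cases "pdx u x t = 0")
      case False
      then have pos: "0 < pdx u x t" using nonneg[OF t, of x] by simp
      have "pdx u x t powr p = pdx u x t powr (p - 1) * pdx u x t"
        using pos by (simp add: powr_diff)
      also have "\<dots> \<le> (1 / t) powr (p - 1) * pdx u x t"
        using pos p le_inv[OF t] by (intro mult_right_mono powr_mono2) auto
      also have "(1 / t) powr (p - 1) = t powr (1 - p)"
        using t by (simp add: powr_divide powr_minus_divide[symmetric])
      finally show ?thesis using pos by simp
    qed simp
    have I: "integrable lborel (\<lambda>x. t powr (1 - p) * pdx u x t)"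
      using ux_int(1)[OF t] by (rule integrable_mult_right)
    have [measurable]: "(\<lambda>x. pdx u x t) \<in> borel_measurable borel"
      using borel_measurable_integrable[OF ux_int(1)[OF t]] by simp
    have int: "integrable lborel (\<lambda>x. \<bar>pdx u x t\<bar> powr p)"
      using le by (intro Bochner_Integration.integrable_bound[OF I])
        (auto intro!: order_trans[OF _ abs_ge_self])
    have "(LINT x|lborel. \<bar>pdx u x t\<bar> powr p) \<le> (LINT x|lborel. t powr (1 - p) * pdx u x t)"
      using int I le by (rule integral_mono)
    also have "\<dots> \<le> t powr (1 - p) * V"
      using ux_int(2)[OF t] by (simp add: mult_left_mono)
    finally have "(LINT x|lborel. \<bar>pdx u x t\<bar> powr p) powr (1 / p) \<le> (t powr (1 - p) * V) powr (1 / p)"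
      using p by (intro powr_mono2) (auto intro!: integral_nonneg_AE)
    also have "\<dots> = t powr ((1 - p) * (1 / p)) * V powr (1 / p)"
      using V0 by (simp add: powr_mult powr_powr)
    also have "(1 - p) * (1 / p) = -1 + 1 / p" using p by (simp add: field_simps)
    finally show ?thesis using int by blast
  qed
  \<comment> \<open>The pointwise bound by \<open>1 / t\<close> is the case of infinite exponent,
    where the power of the mass is read as 1.\<close>
  show ?thesis
    using nonneg le_inv Lp unfolding V_def by auto
qed

end
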